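(* Let $\Bbbk$ be a field and let $R$ be a standard graded $\Bbbk$-algebra whose $h$-polynomial $h(R,x)$ is irreducible over $\mathbb{Q}$. Then $R$ is Hilbert-cyclotomic if and only if $R$ is a complete intersection.
   Context: A graded algebra is a commutative finitely generated $\mathbb{N}$-graded $\Bbbk$-algebra $R=\bigoplus_{i\in\mathbb{N}}R_i$ with $R_0=\Bbbk$ a field. It is standard graded if it is generated as a $\Bbbk$-algebra by $R_1$. Its Hilbert series is $H(R,x)=\sum_{i\ge0}(\dim_{\Bbbk}R_i)x^i$. If $R$ is standard graded of Krull dimension $d$, then $H(R,x)=h(R,x)/(1-x)^d$ for a unique polynomial $h(R,x)\in\mathbb{Z}[x]$ with $h(R,1)\neq0$ and $h(R,0)=1$; this is the $h$-polynomial of $R$, i.e. the numerator of the Hilbert series reduced to lowest terms. Irreducible over $\mathbb{Q}$ means irreducible as an element of $\mathbb{Q}[x]$ (in particular nonconstant). A standard graded algebra $R$ is Hilbert-cyclotomic if all complex roots of $h(R,x)$ lie on the unit circle. A graded algebra $R$ is a (graded) complete intersection if it is isomorphic, as a graded algebra, to a quotient of a positively graded polynomial ring $\Bbbk[x_1,\dots,x_n]$ (each $x_i$ homogeneous of positive degree) by an ideal generated by a (possibly empty) homogeneous regular sequence. *)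

theory Defs
  imports
    "HOL-Library.Poly_Mapping"
    "HOL-Library.Extended_Nat"
    "HOL-Computational_Algebra.Computational_Algebra"
    Complex_Main
begin

section \<open>Graded algebras\<close>

text \<open>
  The underlying ring is the type \<^typ>\<open>'a::comm_ring_1\<close> and the ground field is the type
  \<^typ>\<open>'k::field\<close>; \<open>scale\<close> is the scalar multiplication and \<open>gr i\<close> the homogeneous component
  of degree \<open>i\<close>.
\<close>

locale commutative_algebra = vector_space scale
  for scale :: "'k::field \<Rightarrow> 'a::comm_ring_1 \<Rightarrow> 'a" +
  assumes scale_mult_left: "scale c (x * y) = scale c x * y"

definition is_subalgebra :: "('k::field \<Rightarrow> 'a::comm_ring_1 \<Rightarrow> 'a) \<Rightarrow> 'a set \<Rightarrow> bool" where
  "is_subalgebra scale S \<longleftrightarrow>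
     module.subspace scale S \<and> 1 \<in> S \<and> (\<forall>x\<in>S. \<forall>y\<in>S. x * y \<in> S)"

definition generates_algebra :: "('k::field \<Rightarrow> 'a::comm_ring_1 \<Rightarrow> 'a) \<Rightarrow> 'a set \<Rightarrow> bool" where
  "generates_algebra scale X \<longleftrightarrow> is_subalgebra scale hull X = UNIV"

locale graded_algebra = commutative_algebra scale
  for scale :: "'k::field \<Rightarrow> 'a::comm_ring_1 \<Rightarrow> 'a" +
  fixes gr :: "nat \<Rightarrow> 'a set"
  assumes subspace_gr: "subspace (gr i)"
    and direct_sum: "\<exists>!c::nat \<Rightarrow> 'a. (\<forall>i. c i \<in> gr i) \<and> finite {i. c i \<noteq> 0} \<and>
                        x = (\<Sum>i | c i \<noteq> 0. c i)"
    and mult_gr: "x \<in> gr i \<Longrightarrow> y \<in> gr j \<Longrightarrow> x * y \<in> gr (i + j)"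
    and gr_0: "gr 0 = range (\<lambda>c. scale c 1)"
    and finitely_generated: "\<exists>X. finite X \<and> generates_algebra scale X"

locale standard_graded_algebra = graded_algebra scale gr
  for scale :: "'k::field \<Rightarrow> 'a::comm_ring_1 \<Rightarrow> 'a" and gr :: "nat \<Rightarrow> 'a set" +
  assumes generated_by_gr_1: "generates_algebra scale (gr 1)"


section \<open>Krull dimension\<close>

definition is_prime_ideal :: "'a::comm_ring_1 set \<Rightarrow> bool" where
  "is_prime_ideal P \<longleftrightarrow> module.subspace (*) P \<and> P \<noteq> UNIV \<and>
     (\<forall>x y. x * y \<in> P \<longrightarrow> x \<in> P \<or> y \<in> P)"

definition krull_dim :: "'a::comm_ring_1 itself \<Rightarrow> enat" where
  "krull_dim _ = Sup {enat n | n. \<exists>P :: nat \<Rightarrow> 'a set.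
     (\<forall>i\<le>n. is_prime_ideal (P i)) \<and> (\<forall>i<n. P i \<subset> P (Suc i))}"


section \<open>Hilbert series and h-polynomial\<close>

definition hilbert_series ::
    "('k::field \<Rightarrow> 'a::comm_ring_1 \<Rightarrow> 'a) \<Rightarrow> (nat \<Rightarrow> 'a set) \<Rightarrow> int fps" where
  "hilbert_series scale gr = Abs_fps (\<lambda>i. int (vector_space.dim scale (gr i)))"

text \<open>\<open>H(R,x) = h(x) / (1 - x)^d\<close> is stated after clearing the denominator.\<close>

definition is_h_polynomial ::
    "('k::field \<Rightarrow> 'a::comm_ring_1 \<Rightarrow> 'a) \<Rightarrow> (nat \<Rightarrow> 'a set) \<Rightarrow> int poly \<Rightarrow> bool" where
  "is_h_polynomial scale gr h \<longleftrightarrow>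
     (\<exists>d. krull_dim TYPE('a) = enat d \<and>
          hilbert_series scale gr * (1 - fps_X) ^ d = fps_of_poly h) \<and>
     poly h 1 \<noteq> 0 \<and> poly h 0 = 1"

lemma is_h_polynomial_unique:
  assumes "is_h_polynomial scale gr h" "is_h_polynomial scale gr h'"
  shows "h = h'"
proof -
  have "fps_of_poly h = fps_of_poly h'"
    using assms unfolding is_h_polynomial_def by (metis enat.inject)
  thus ?thesis by simp
qed

text \<open>
  For a standard graded algebra the h-polynomial always exists, by the Hilbert--Serre theorem and
  dimension theory; 0 is only the value for arguments that are not standard graded algebras.
\<close>

definition h_polynomial ::
    "('k::field \<Rightarrow> 'a::comm_ring_1 \<Rightarrow> 'a) \<Rightarrow> (nat \<Rightarrow> 'a set) \<Rightarrow> int poly" where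
  "h_polynomial scale gr =
     (if \<exists>h. is_h_polynomial scale gr h then THE h. is_h_polynomial scale gr h else 0)"

definition hilbert_cyclotomic ::
    "('k::field \<Rightarrow> 'a::comm_ring_1 \<Rightarrow> 'a) \<Rightarrow> (nat \<Rightarrow> 'a set) \<Rightarrow> bool" where
  "hilbert_cyclotomic scale gr \<longleftrightarrow>
     (\<forall>z::complex. poly (map_poly of_int (h_polynomial scale gr)) z = 0 \<longrightarrow> cmod z = 1)"


section \<open>Positively graded polynomial rings\<close>

text \<open>
  A polynomial in the variables \<open>x\<^sub>0, x\<^sub>1, \<dots>\<close> is a finitely supported function from exponent
  vectors to coefficients; \<open>mpoly_ring n\<close> is the polynomial ring in \<open>x\<^sub>0, \<dots>, x\<^sub>n\<^sub>-\<^sub>1\<close>.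
\<close>

type_synonym 'k mpoly = "(nat \<Rightarrow>\<^sub>0 nat) \<Rightarrow>\<^sub>0 'k"

definition mpoly_ring :: "nat \<Rightarrow> 'k::field mpoly set" where
  "mpoly_ring n = {p. \<forall>m\<in>Poly_Mapping.keys p. Poly_Mapping.keys m \<subseteq> {..<n}}"

definition weighted_degree :: "(nat \<Rightarrow> nat) \<Rightarrow> (nat \<Rightarrow>\<^sub>0 nat) \<Rightarrow> nat" where
  "weighted_degree w m = (\<Sum>i\<in>Poly_Mapping.keys m. w i * Poly_Mapping.lookup m i)"

definition mpoly_homogeneous :: "(nat \<Rightarrow> nat) \<Rightarrow> nat \<Rightarrow> 'k::field mpoly \<Rightarrow> bool" where
  "mpoly_homogeneous w e p \<longleftrightarrow> (\<forall>m\<in>Poly_Mapping.keys p. weighted_degree w m = e)"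

definition mpoly_const :: "'k::field \<Rightarrow> 'k mpoly" where
  "mpoly_const c = Poly_Mapping.single 0 c"

definition mpoly_ideal :: "nat \<Rightarrow> 'k::field mpoly list \<Rightarrow> 'k mpoly set" where
  "mpoly_ideal n fs =
     {\<Sum>j<length fs. g j * fs ! j | g. \<forall>j<length fs. g j \<in> mpoly_ring n}"

definition regular_sequence :: "nat \<Rightarrow> 'k::field mpoly list \<Rightarrow> bool" where
  "regular_sequence n fs \<longleftrightarrow>
     set fs \<subseteq> mpoly_ring n \<and>
     (\<forall>j<length fs. \<forall>g\<in>mpoly_ring n.
        fs ! j * g \<in> mpoly_ideal n (take j fs) \<longrightarrow> g \<in> mpoly_ideal n (take j fs)) \<and>
     mpoly_ideal n fs \<noteq> mpoly_ring n"

definition mpoly_coset :: "nat \<Rightarrow> 'k::field mpoly list \<Rightarrow> 'k mpoly \<Rightarrow> 'k mpoly set" where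
  "mpoly_coset n fs p = (\<lambda>q. p + q) ` mpoly_ideal n fs"


section \<open>Complete intersections\<close>

text \<open>
  \<open>\<Phi>\<close> is an isomorphism of graded algebras from \<open>k[x\<^sub>0,\<dots>,x\<^sub>n\<^sub>-\<^sub>1]/(fs)\<close>, with \<open>x\<^sub>i\<close> of degree
  \<open>w i\<close>, onto the algebra given by \<open>scale\<close> and \<open>gr\<close>. The elements of the quotient are the
  cosets \<open>p + (fs)\<close>, and its component of degree \<open>i\<close> consists of the cosets of the homogeneous
  polynomials of degree \<open>i\<close>.
\<close>

definition is_graded_quotient_iso ::
    "nat \<Rightarrow> (nat \<Rightarrow> nat) \<Rightarrow> 'k::field mpoly list \<Rightarrow>
     ('k \<Rightarrow> 'a::comm_ring_1 \<Rightarrow> 'a) \<Rightarrow> (nat \<Rightarrow> 'a set) \<Rightarrow> ('k mpoly set \<Rightarrow> 'a) \<Rightarrow> bool" where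
  "is_graded_quotient_iso n w fs scale gr \<Phi> \<longleftrightarrow>
     bij_betw \<Phi> (mpoly_coset n fs ` mpoly_ring n) UNIV \<and>
     (\<forall>p\<in>mpoly_ring n. \<forall>q\<in>mpoly_ring n.
        \<Phi> (mpoly_coset n fs (p + q)) = \<Phi> (mpoly_coset n fs p) + \<Phi> (mpoly_coset n fs q) \<and>
        \<Phi> (mpoly_coset n fs (p * q)) = \<Phi> (mpoly_coset n fs p) * \<Phi> (mpoly_coset n fs q)) \<and>
     \<Phi> (mpoly_coset n fs 1) = 1 \<and>
     (\<forall>c. \<forall>p\<in>mpoly_ring n.
        \<Phi> (mpoly_coset n fs (mpoly_const c * p)) = scale c (\<Phi> (mpoly_coset n fs p))) \<and>
     (\<forall>i. \<Phi> ` mpoly_coset n fs ` {p \<in> mpoly_ring n. mpoly_homogeneous w i p} = gr i)"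

definition complete_intersection ::
    "('k::field \<Rightarrow> 'a::comm_ring_1 \<Rightarrow> 'a) \<Rightarrow> (nat \<Rightarrow> 'a set) \<Rightarrow> bool" where
  "complete_intersection scale gr \<longleftrightarrow>
     (\<exists>n w fs \<Phi>.
        (\<forall>i<n. w i > 0) \<and>
        (\<forall>f\<in>set fs. \<exists>e. mpoly_homogeneous w e f) \<and>
        regular_sequence n fs \<and>
        is_graded_quotient_iso n w fs scale gr \<Phi>)"

end

theory Submission
  imports Defs "HOL-Computational_Algebra.Field_as_Ring"
begin

text \<open>
  The Krull dimension only enters as the order \<open>d\<close> of the pole of the Hilbert series at 1.

  If all roots of \<open>h\<close> lie on the unit circle, then \<open>h\<close> divides some \<open>x\<^sup>N - 1\<close>; take \<open>N\<close> least. If \<open>N = a b\<close>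
  with coprime \<open>a, b > 1\<close>, then \<open>h(1)\<close> divides both \<open>a\<close> and \<open>b\<close>, so \<open>h(1) = 1\<close>. If \<open>N\<close> is a power of a
  prime \<open>p\<close> and \<open>h(1) \<noteq> 1\<close>, then \<open>h\<close> is the cyclotomic polynomial
  \<open>1 + x\<^sup>q + \<dots> + x\<^sup>(\<^sup>p\<^sup>-\<^sup>1\<^sup>)\<^sup>q\<close> with \<open>q = N / p\<close>. On the other hand, the standard monomials of the algebra
  are an order ideal, so a pole of order \<open>d\<close> forces them to contain all monomials in some \<open>d\<close> of the
  variables, whence \<open>H \<ge> 1 / (1 - x)\<^sup>d\<close> coefficientwise. This excludes \<open>h(1) = 1\<close>, because \<open>h'(1) > 0\<close>. It
  also excludes \<open>q > 1\<close>, where the linear coefficient of \<open>h\<close> vanishes: then the number of generators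
  is \<open>d\<close>, so the algebra is a polynomial ring and \<open>h = 1\<close>. So \<open>H = (1 - x\<^sup>p) / (1 - x)\<^sup>d\<^sup>+\<^sup>1\<close> and the algebra is
  a hypersurface of degree \<open>p\<close>.

  Conversely, the Hilbert series of a complete intersection is a quotient of products of factors
  \<open>1 - x\<^sup>e\<close>, so all roots of \<open>h\<close> are roots of unity.
\<close>

subsection \<open>Irreducible integer polynomials with all roots on the unit circle\<close>

text \<open>The value h(1) is the multiplicity of the algebra. The algebra need not be
  Cohen-Macaulay, so h may have negative coefficients, and multiplicity one does not force a
  polynomial ring: k[x,y]/(x^2, xy) has h = 1 + x - x^2. What separates this example from a
  polynomial with all roots on the unit circle is the next term of the pole. If h(1) = 1, the series
  H - 1/(1 - x)^d has the numerator h - 1, which vanishes at 1, and its coefficients can be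
  nonnegative only if h'(1) \<le> 0; in the example h'(1) = -1. Irreducibility enters mainly through
  primality of h in Z[x]: since N is least, h does not divide x^a - 1 for a proper divisor a of N,
  hence it divides the cofactor of x^a - 1 in x^N - 1, whose value at 1 is N / a.\<close>

lemma map_poly_of_int_mult:
  "map_poly of_int (p * q) = (map_poly of_int p * map_poly of_int q :: 'a :: comm_ring_1 poly)"
  by (intro poly_eqI) (simp add: coeff_map_poly coeff_mult)

lemma map_poly_of_int_diff:
  "map_poly of_int (p - q) = (map_poly of_int p - map_poly of_int q :: 'a :: comm_ring_1 poly)"
  by (intro poly_eqI) (simp add: coeff_map_poly)

lemma map_poly_of_int_1: "map_poly of_int 1 = (1 :: 'a :: comm_ring_1 poly)"
  by simp

lemma map_poly_of_int_monom: "map_poly of_int (monom c n) = (monom (of_int c) n :: 'a :: comm_ring_1 poly)"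
  by (intro poly_eqI) (simp add: coeff_map_poly)

lemma poly_map_poly_of_int: "poly (map_poly of_int p) (of_int x) = (of_int (poly p x) :: 'a :: comm_ring_1)"
  by (induction p) (simp_all add: map_poly_pCons)

lemma degree_map_poly_of_int: "degree (map_poly of_int p :: 'a :: {comm_ring_1,ring_char_0} poly) = degree p"
  by (rule degree_map_poly) auto

lemma degree_pos_if_irreducible_rat:
  fixes h :: "int poly"
  assumes irr: "irreducible (map_poly rat_of_int h)"
  shows "degree h > 0"
proof (rule ccontr)
  assume "\<not> degree h > 0"
  hence "degree (map_poly rat_of_int h) = 0" by (simp add: degree_map_poly_of_int)
  moreover have "map_poly rat_of_int h \<noteq> 0" using irr by auto
  ultimately have "map_poly rat_of_int h dvd 1" by (simp add: is_unit_iff_degree)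
  thus False using irr irreducible_not_unit by blast
qed

text \<open>A factor that is a unit over the rationals is constant; the leading coefficients of the
  two factors multiply to 1 or -1, so this constant is a unit of the integers. Since Z[x] is
  factorial, \<open>h\<close> thereby becomes a prime element.\<close>

lemma irreducible_int_poly_if_rat:
  fixes h :: "int poly"
  assumes "irreducible (map_poly rat_of_int h)" and lc: "\<bar>lead_coeff h\<bar> = 1"
  shows "irreducible h"
proof (rule irreducibleI)
  show "h \<noteq> 0" using assms by auto
  have "\<not> map_poly rat_of_int h dvd 1"
    using assms(1) by (rule irreducible_not_unit)
  thus "\<not> h dvd 1"
    by (metis dvd_def map_poly_of_int_mult map_poly_of_int_1)
next
  fix a b assume ab: "h = a * b"
  have "map_poly rat_of_int h = map_poly of_int a * map_poly of_int b"
    by (simp add: ab map_poly_of_int_mult)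
  hence "map_poly rat_of_int a dvd 1 \<or> map_poly rat_of_int b dvd 1"
    using assms(1) irreducibleD by blast
  hence deg: "degree a = 0 \<or> degree b = 0"
    by (metis degree_map_poly_of_int is_unit_iff_degree not_is_unit_0)
  have "\<bar>lead_coeff a\<bar> * \<bar>lead_coeff b\<bar> = 1"
    using lc by (simp add: ab lead_coeff_mult abs_mult)
  hence "\<bar>lead_coeff a\<bar> = 1" "\<bar>lead_coeff b\<bar> = 1"
    by (metis abs_ge_zero abs_zmult_eq_1 abs_mult abs_abs mult.commute)+
  with deg show "a dvd 1 \<or> b dvd 1"
    by (auto elim!: degree_eq_zeroE simp: is_unit_const_poly_iff abs_eq_iff)
qed

section \<open>Kronecker's theorem on integer polynomials with all roots on the unit circle\<close>

lemma norm_lead_coeff_if_unimodular_roots: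
  fixes p :: "complex poly"
  assumes "\<And>z. poly p z = 0 \<Longrightarrow> cmod z = 1"
  shows "cmod (lead_coeff p) = cmod (poly p 0)"
proof (cases "p = 0")
  case False
  have "poly p 0 = poly (smult (lead_coeff p) (\<Prod>z|poly p z = 0. [:-z, 1:] ^ order z p)) 0"
    using complex_poly_decompose[of p] by simp
  also have "\<dots> = lead_coeff p * (\<Prod>z|poly p z = 0. (- z) ^ order z p)"
    by (simp add: poly_prod)
  finally have "cmod (poly p 0) = cmod (lead_coeff p) * (\<Prod>z|poly p z = 0. cmod z ^ order z p)"
    by (simp add: norm_mult prod_norm norm_power flip: prod_norm)
  also have "(\<Prod>z|poly p z = 0. cmod z ^ order z p) = 1"
    by (rule prod.neutral) (auto simp: assms)
  finally show ?thesis by simp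
qed auto

text \<open>Lagrange interpolation: a polynomial of degree less than \<open>card Z\<close> is a
  combination of fixed basis polynomials with its values on \<open>Z\<close> as coefficients. This
  is meant for the remainders of the powers of x modulo \<open>h\<close>, whose values at the roots
  of \<open>h\<close> have modulus 1.\<close>

lemma coeff_bound_from_values:
  fixes Z :: "complex set"
  assumes "finite Z"
  obtains C where "\<And>p i. degree p < card Z \<Longrightarrow> (\<And>z. z \<in> Z \<Longrightarrow> cmod (poly p z) \<le> 1) \<Longrightarrow> cmod (coeff p i) \<le> C"
proof -
  define L where "L z = (\<Prod>w\<in>Z-{z}. smult (1 / (z - w)) [:-w, 1:])" for z
  have L1: "poly (L z) z = 1" if "z \<in> Z" for z
    unfolding L_def poly_prod by (rule prod.neutral) (auto simp: diff_divide_distrib[symmetric])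
  have L0: "poly (L z) w = 0" if "z \<in> Z" "w \<in> Z" "z \<noteq> w" for z w
    unfolding L_def poly_prod using that assms by (intro prod_zero) auto
  have Ld: "degree (L z) < card Z" if "z \<in> Z" for z
  proof -
    have "degree (L z) \<le> sum (degree \<circ> (\<lambda>w. smult (1 / (z - w)) [:-w, 1:])) (Z - {z})"
      unfolding L_def by (rule degree_prod_sum_le) (use assms in auto)
    also have "\<dots> \<le> (\<Sum>w\<in>Z-{z}. 1)"
      by (rule sum_mono) auto
    also have "\<dots> < card Z"
    proof -
      have "card Z > 0" using that assms by (auto simp: card_gt_0_iff)
      thus ?thesis using that assms by simp
    qed
    finally show ?thesis .
  qed
  have lag: "p = (\<Sum>z\<in>Z. smult (poly p z) (L z))" if "degree p < card Z" for p
  proof (rule poly_eqI_degree[of Z])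
    fix w assume w: "w \<in> Z"
    have "poly (\<Sum>z\<in>Z. smult (poly p z) (L z)) w = (\<Sum>z\<in>Z. if z = w then poly p w else 0)"
      unfolding poly_sum by (rule sum.cong) (use w L0 L1 in auto)
    thus "poly p w = poly (\<Sum>z\<in>Z. smult (poly p z) (L z)) w"
      using assms w by simp
  next
    have "degree (\<Sum>z\<in>Z. smult (poly p z) (L z)) \<le> card Z - 1"
      by (rule degree_sum_le) (use assms Ld in \<open>auto intro!: order.trans[OF degree_smult_le] simp: less_Suc_eq_le[symmetric]\<close>, metis Suc_pred Ld card_gt_0_iff empty_iff)
    thus "degree (\<Sum>z\<in>Z. smult (poly p z) (L z)) < card Z"
      using that by linarith
  qed (use that in auto)
  define N where "N = card Z"
  \<comment> \<open>Summing over all degrees up to \<open>N\<close> gives one bound for all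
    coefficients; beyond \<open>N\<close> they vanish.\<close>
  define C where "C = (\<Sum>j\<le>N. \<Sum>z\<in>Z. cmod (coeff (L z) j))"
  show ?thesis
  proof (rule that[of C])
    fix p i assume p: "degree p < card Z" "\<And>z. z \<in> Z \<Longrightarrow> cmod (poly p z) \<le> 1"
    show "cmod (coeff p i) \<le> C"
    proof (cases "i \<le> N")
      case True
      have "cmod (coeff p i) = cmod (\<Sum>z\<in>Z. poly p z * coeff (L z) i)"
        by (subst lag[OF p(1)]) (simp add: coeff_sum)
      also have "\<dots> \<le> (\<Sum>z\<in>Z. cmod (coeff (L z) i))"
        by (rule sum_norm_le) (use p(2) in \<open>auto simp: norm_mult intro: mult_left_le_one_le\<close>)
      also have "\<dots> \<le> C"
        unfolding C_def using True by (intro member_le_sum) (auto intro: sum_nonneg)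
      finally show ?thesis .
    next
      case False
      hence "coeff p i = 0" using p(1) by (intro coeff_eq_0) (auto simp: N_def)
      thus ?thesis by (auto simp: C_def intro!: sum_nonneg)
    qed
  qed
qed

lemma finite_bounded_int_polys: "finite {p :: int poly. degree p < n \<and> (\<forall>i. \<bar>coeff p i\<bar> \<le> B)}" (is "finite ?S")
proof -
  have "?S \<subseteq> Poly ` {xs. set xs \<subseteq> {-B..B} \<and> length xs \<le> n}"
  proof
    fix p assume p: "p \<in> ?S"
    have "set (coeffs p) \<subseteq> {-B..B}"
    proof
      fix c assume "c \<in> set (coeffs p)"
      then obtain i where "c = coeff p i"
        by (auto simp: coeffs_def split: if_splits)
      thus "c \<in> {-B..B}" using p by (auto simp: abs_le_iff dest: spec[of _ i])
    qed
    moreover have "length (coeffs p) \<le> n"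
      using p by (cases "p = 0") (auto simp: length_coeffs_degree)
    ultimately show "p \<in> Poly ` {xs. set xs \<subseteq> {-B..B} \<and> length xs \<le> n}"
      by (intro image_eqI[of _ _ "coeffs p"]) auto
  qed
  moreover have "finite {xs. set xs \<subseteq> {-B..B} \<and> length xs \<le> n}"
    by (rule finite_lists_length_le) auto
  ultimately show ?thesis by (meson finite_imageI finite_subset)
qed

text \<open>Division with remainder by \<open>h\<close> stays over the integers because the leading
  coefficient is 1 or -1; the remainder of x^(j+1) comes from x times the remainder of x^j.\<close>

lemma remainder_monom:
  fixes h :: "int poly"
  assumes lc: "\<bar>lead_coeff h\<bar> = 1" and deg: "degree h > 0"
  shows "\<exists>r. degree r < degree h \<and> h dvd monom 1 j - r"
proof (induction j)
  case 0
  show ?case by (intro exI[of _ 1]) (use deg in \<open>auto simp: monom_0 one_pCons\<close>)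
next
  case (Suc j)
  then obtain r where r: "degree r < degree h" "h dvd monom 1 j - r" by blast
  \<comment> \<open>\<open>lead_coeff h\<close> is its own inverse, so this \<open>c\<close> makes
    the coefficient of \<open>s\<close> at \<open>degree h\<close> vanish.\<close>
  define c where "c = coeff (pCons 0 r) (degree h) * lead_coeff h"
  define s where "s = pCons 0 r - smult c h"
  have lc2: "lead_coeff h * lead_coeff h = 1"
    using lc by (metis abs_mult_self_eq mult.right_neutral)
  have "degree s \<le> degree h"
    unfolding s_def using r(1) by (intro degree_diff_le) (auto simp: degree_pCons_eq_if)
  moreover have "coeff s (degree h) = 0"
    using lc2 by (simp add: s_def c_def mult.assoc)
  ultimately have "degree s < degree h"
    using deg by (metis eq_zero_or_degree_less degree_0)
  moreover have "monom 1 (Suc j) - s = pCons 0 (monom 1 j - r) + smult c h"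
    by (simp add: s_def monom_Suc)
  moreover have "h dvd pCons 0 (monom 1 j - r)"
    using dvd_mult[OF r(2), of "[:0, 1:]"] by simp
  ultimately have "h dvd monom 1 (Suc j) - s"
    by (simp add: dvd_smult)
  with \<open>degree s < degree h\<close> show ?case by blast
qed

text \<open>Pigeonhole: the remainders of the x^j modulo \<open>h\<close> have bounded degree and
  bounded integer coefficients, so two of them coincide, and \<open>h\<close> divides x^j (x^(l - j)
  - 1) for some j < l. Being prime and not a divisor of x, it divides the second factor.\<close>

lemma unimodular_int_poly_dvd_root_of_unity:
  fixes h :: "int poly"
  assumes irr: "irreducible (map_poly rat_of_int h)"
    and h0: "poly h 0 = 1"
    and lc: "\<bar>lead_coeff h\<bar> = 1"
    and roots: "\<And>z::complex. poly (map_poly of_int h) z = 0 \<Longrightarrow> cmod z = 1"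
  shows "\<exists>N>0. h dvd monom 1 N - 1"
proof -
  define Z where "Z = {z::complex. poly (map_poly of_int h) z = 0}"
  have hnz: "h \<noteq> 0" using h0 by auto
  have deg: "degree h > 0" using irr by (rule degree_pos_if_irreducible_rat)
  \<comment> \<open>Distinct roots are needed so that \<open>Z\<close> has at least
    \<open>degree h\<close> points and the values on \<open>Z\<close> control a remainder. Over the
    rationals \<open>h\<close> is coprime to its derivative, and the Bezout identity carries over to
    the complex numbers.\<close>
  have "rsquarefree (map_poly of_int h :: complex poly)"
    unfolding rsquarefree_roots
  proof (intro allI notI, elim conjE)
    fix z :: complex
    assume z: "poly (map_poly of_int h) z = 0" "poly (pderiv (map_poly of_int h)) z = 0"
    let ?q = "map_poly rat_of_int h"
    have "degree (pderiv ?q) < degree ?q" "pderiv ?q \<noteq> 0"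
      using deg by (auto simp: degree_pderiv degree_map_poly_of_int pderiv_eq_0_iff)
    hence "\<not> ?q dvd pderiv ?q" using dvd_imp_degree_le by fastforce
    hence "coprime ?q (pderiv ?q)"
      using irr by (meson coprimeI dvd_trans irreducibleD')
    hence "fst (bezout_coefficients ?q (pderiv ?q)) * ?q + snd (bezout_coefficients ?q (pderiv ?q)) * pderiv ?q = 1"
      by (simp add: bezout_coefficients_fst_snd)
    then obtain a b where ab: "a * ?q + b * pderiv ?q = 1" by blast
    let ?m = "map_poly of_rat :: rat poly \<Rightarrow> complex poly"
    have m: "?m (p + p') = ?m p + ?m p'" "?m (p * p') = ?m p * ?m p'" "?m (pderiv p) = pderiv (?m p)" for p p'
      by (intro poly_eqI; simp add: coeff_map_poly coeff_mult of_rat_add of_rat_mult of_rat_sum coeff_pderiv)+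
    have mq: "?m ?q = map_poly of_int h"
      by (intro poly_eqI) (simp add: coeff_map_poly)
    have "?m a * map_poly of_int h + ?m b * pderiv (map_poly of_int h) = 1"
      using arg_cong[OF ab, of ?m] by (simp add: m mq)
    from arg_cong[OF this, of "\<lambda>p. poly p z"] z show False by simp
  qed
  hence dec: "smult (of_int (lead_coeff h)) (\<Prod>z\<in>Z. [:-z, 1:]) = (map_poly of_int h :: complex poly)"
    using complex_poly_decompose_rsquarefree[of "map_poly of_int h"]
    by (simp add: Z_def degree_map_poly_of_int coeff_map_poly)
  have fin: "finite Z"
    unfolding Z_def using hnz by (intro poly_roots_finite) (metis degree_map_poly_of_int deg degree_0 less_irrefl)
  have card: "degree h \<le> card Z"
  proof -
    have "degree h = degree (smult (of_int (lead_coeff h)) (\<Prod>z\<in>Z. [:-z, 1:]) :: complex poly)"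
      using dec by (simp add: degree_map_poly_of_int)
    also have "\<dots> \<le> degree (\<Prod>z\<in>Z. [:-z, 1:] :: complex poly)"
      by (rule degree_smult_le)
    also have "\<dots> \<le> sum (degree \<circ> (\<lambda>z. [:-z, 1:])) Z"
      by (rule degree_prod_sum_le) (rule fin)
    finally show ?thesis by simp
  qed
  obtain C where C: "\<And>p i. degree p < card Z \<Longrightarrow> (\<And>z. z \<in> Z \<Longrightarrow> cmod (poly p z) \<le> 1) \<Longrightarrow> cmod (coeff p i) \<le> C"
    using coeff_bound_from_values[OF fin] by blast
  obtain r where r: "\<And>j. degree (r j) < degree h" "\<And>j. h dvd monom 1 j - r j"
    using remainder_monom[OF lc deg] by metis
  have "r j \<in> {p. degree p < degree h \<and> (\<forall>i. \<bar>coeff p i\<bar> \<le> \<lceil>C\<rceil>)}" for j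
  proof -
    have "\<bar>coeff (r j) i\<bar> \<le> \<lceil>C\<rceil>" for i
    proof -
      have "cmod (coeff (map_poly of_int (r j)) i) \<le> C"
      proof (rule C)
        show "degree (map_poly of_int (r j) :: complex poly) < card Z"
          using r(1)[of j] card by (simp add: degree_map_poly_of_int)
        fix z assume z: "z \<in> Z"
        obtain q where "monom 1 j - r j = h * q" using r(2)[of j] by (auto elim: dvdE)
        from arg_cong[OF this, of "\<lambda>p. poly (map_poly of_int p) z"]
        have "poly (map_poly of_int (r j)) z = z ^ j"
          using z by (simp add: map_poly_of_int_mult map_poly_of_int_diff map_poly_of_int_monom Z_def poly_monom)
        thus "cmod (poly (map_poly of_int (r j)) z) \<le> 1"
          using z roots by (simp add: Z_def norm_power)
      qed
      hence "real_of_int \<bar>coeff (r j) i\<bar> \<le> C" by (simp add: coeff_map_poly)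
      thus ?thesis by (metis ceiling_mono ceiling_of_int)
    qed
    thus ?thesis using r(1) by simp
  qed
  hence "finite (range r)"
    by (intro finite_subset[OF _ finite_bounded_int_polys[of "degree h" "\<lceil>C\<rceil>"]]) blast
  hence "\<not> inj r" using finite_imageD infinite_UNIV_nat by blast
  then obtain j l where jl: "j < l" "r j = r l"
    unfolding inj_def by (metis linorder_neqE_nat)
  have "h dvd (monom 1 l - r l) - (monom 1 j - r j)"
    by (rule dvd_diff) (rule r(2))+
  also have "\<dots> = monom 1 j * (monom 1 (l - j) - 1)"
    using jl by (simp add: algebra_simps mult_monom)
  finally have d: "h dvd monom 1 j * (monom 1 (l - j) - 1)" .
  have "prime_elem h"
    using irreducible_int_poly_if_rat[OF irr lc] by (rule irreducible_imp_prime_elem)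
  \<comment> \<open>Since h(0) = 1, x divides \<open>h - 1\<close>; a divisor \<open>h\<close> of x
    would therefore divide 1.\<close>
  moreover have "\<not> h dvd monom 1 j"
  proof
    assume "h dvd monom 1 j"
    hence "h dvd monom 1 1 ^ j" by (simp add: monom_power)
    hence "h dvd monom 1 1" using \<open>prime_elem h\<close> prime_elem_dvd_power by blast
    moreover have "monom 1 1 dvd h - 1"
    proof -
      have "[:-0, 1:] dvd h - 1" by (subst poly_eq_0_iff_dvd[symmetric]) (simp add: h0)
      thus ?thesis by (simp add: monom_Suc monom_0)
    qed
    ultimately have "h dvd h - 1" by (rule dvd_trans)
    hence "h dvd h - (h - 1)" by (rule dvd_diff[OF dvd_refl])
    also have "h - (h - 1) = 1" by simp
    finally have "h dvd 1" .
    thus False using \<open>prime_elem h\<close> by (simp add: prime_elem_def)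
  qed
  ultimately have "h dvd monom 1 (l - j) - 1" using d prime_elem_dvd_mult_iff by blast
  thus ?thesis using jl(1) by (intro exI[of _ "l - j"]) auto
qed

text \<open>The logarithmic derivative p'(1)/p(1) is the sum of 1/(1 - z) over the roots z with
  multiplicity, and 1/(1 - z) maps the unit circle without 1 into the line of real part 1/2.\<close>

lemma pderiv_at_1_unimodular_roots:
  fixes p :: "complex poly"
  assumes roots: "\<And>z. poly p z = 0 \<Longrightarrow> cmod z = 1" and p1: "poly p 1 \<noteq> 0"
  shows "Re (poly (pderiv p) 1 / poly p 1) = degree p / 2"
proof -
  have *: "Re (poly (pderiv (\<Prod>i<n. [:-root i, 1:])) 1 / poly (\<Prod>i<n. [:-root i, 1:]) 1) = n / 2"
    if "\<And>i. i < n \<Longrightarrow> cmod (root i) = 1 \<and> root i \<noteq> 1" for root :: "nat \<Rightarrow> complex" and n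
    using that
  proof (induction n)
    case (Suc n)
    define q where "q = (\<Prod>i<n. [:-root i, 1:])"
    have q1: "poly q 1 \<noteq> 0"
      using Suc.prems by (auto simp: q_def poly_prod)
    have r: "cmod (root n) = 1" "root n \<noteq> 1" using Suc.prems by auto
    have "poly (pderiv (q * [:-root n, 1:])) 1 / poly (q * [:-root n, 1:]) 1
        = poly (pderiv q) 1 / poly q 1 + 1 / (1 - root n)"
    proof -
      have "poly (pderiv (q * [:-root n, 1:])) 1 = poly q 1 + (1 - root n) * poly (pderiv q) 1"
        unfolding pderiv_mult by (simp add: pderiv_pCons ring_distribs)
      moreover have "poly (q * [:-root n, 1:]) 1 = (1 - root n) * poly q 1"
        unfolding poly_mult by simp
      ultimately show ?thesis using q1 r by (simp add: divide_simps)
    qed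
    moreover have "Re (1 / (1 - root n)) = 1 / 2"
    proof -
      have n: "(Re (root n))\<^sup>2 + (Im (root n))\<^sup>2 = 1"
        using r by (simp add: cmod_def)
      have "Re (root n) \<noteq> 1"
        using n r by (auto simp: complex_eq_iff)
      moreover have "(1 - Re (root n))\<^sup>2 + (Im (root n))\<^sup>2 = 2 * (1 - Re (root n))"
        using n by (simp add: power2_eq_square algebra_simps)
      ultimately show ?thesis by (simp add: Re_divide field_simps)
    qed
    moreover have "Re (poly (pderiv q) 1 / poly q 1) = n / 2"
      using Suc by (simp add: q_def)
    ultimately show ?case by (simp add: q_def field_simps)
  qed auto
  obtain root where dec: "smult (lead_coeff p) (\<Prod>i<degree p. [:-root i, 1:]) = p"
    using complex_poly_decompose' by blast
  have lc: "lead_coeff p \<noteq> 0" using p1 by auto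
  have "poly p (root i) = 0" if "i < degree p" for i
  proof -
    have "poly (smult (lead_coeff p) (\<Prod>i<degree p. [:-root i, 1:])) (root i) = 0"
      using that by (auto simp: poly_prod)
    thus ?thesis by (simp only: dec)
  qed
  hence "\<And>i. i < degree p \<Longrightarrow> cmod (root i) = 1 \<and> root i \<noteq> 1"
    using roots p1 by metis
  from *[OF this] have "Re (poly (pderiv (\<Prod>i<degree p. [:-root i, 1:])) 1 / poly (\<Prod>i<degree p. [:-root i, 1:]) 1) = degree p / 2"
    by simp
  moreover have "poly (pderiv p) 1 / poly p 1 = poly (pderiv (\<Prod>i<degree p. [:-root i, 1:])) 1 / poly (\<Prod>i<degree p. [:-root i, 1:]) 1"
    using lc by (subst (1 2) dec[symmetric]) (simp add: pderiv_smult)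
  ultimately show ?thesis by simp
qed

lemma pderiv_at_1_pos:
  fixes h :: "int poly"
  assumes roots: "\<And>z::complex. poly (map_poly of_int h) z = 0 \<Longrightarrow> cmod z = 1"
    and h1: "poly h 1 > 0" and deg: "degree h > 0"
  shows "poly (pderiv h) 1 > 0"
proof -
  have p: "poly (map_poly of_int q) (1::complex) = of_int (poly q 1)" for q
    using poly_map_poly_of_int[of q 1, where 'a=complex] by simp
  have d: "pderiv (map_poly of_int h) = (map_poly of_int (pderiv h) :: complex poly)"
    by (intro poly_eqI) (simp add: coeff_map_poly coeff_pderiv)
  have "Re (of_int (poly (pderiv h) 1) / of_int (poly h 1)) = degree h / 2"
    using pderiv_at_1_unimodular_roots[of "map_poly of_int h"] roots h1
    by (simp add: p d degree_map_poly_of_int)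
  hence "real_of_int (poly (pderiv h) 1) / of_int (poly h 1) > 0"
    using deg by (metis Re_complex_of_real divide_pos_pos of_nat_0_less_iff of_real_divide of_real_of_int_eq zero_less_numeral)
  thus ?thesis using h1 by (simp add: zero_less_divide_iff)
qed

section \<open>Divisors of x^N - 1 and their values at 1\<close>

lemma prime_dvd_power_diff_one:
  fixes y :: "'a :: comm_ring_1"
  assumes "prime p"
  shows "of_nat p dvd y ^ p - 1 - (y - 1) ^ p"
proof -
  \<comment> \<open>Expanding y as (y - 1) + 1, and not the power of y - 1, avoids the sign (-1)^p,
    so that p = 2 is no special case.\<close>
  have "y ^ p = (\<Sum>k\<le>p. of_nat (p choose k) * (y - 1) ^ k * 1 ^ (p - k))"
    using binomial_ring[of "y - 1" 1 p] by simp
  also have "{..p} = insert 0 (insert p {0<..<p})" by auto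
  also have "(\<Sum>k\<in>\<dots>. of_nat (p choose k) * (y - 1) ^ k * 1 ^ (p - k)) =
      1 + (y - 1) ^ p + (\<Sum>k\<in>{0<..<p}. of_nat (p choose k) * (y - 1) ^ k)"
    using prime_gt_0_nat[OF assms] by (simp add: add.assoc)
  finally have "y ^ p - 1 - (y - 1) ^ p = (\<Sum>k\<in>{0<..<p}. of_nat (p choose k) * (y - 1) ^ k)"
    by simp
  also have "of_nat p dvd \<dots>"
  proof (rule dvd_sum)
    fix k assume "k \<in> {0<..<p}"
    hence "p dvd (p choose k)" using assms by (intro dvd_choose_prime) auto
    hence "(of_nat p :: 'a) dvd of_nat (p choose k)" by (auto elim!: dvdE)
    thus "of_nat p dvd of_nat (p choose k) * (y - 1) ^ k" by (rule dvd_mult2)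
  qed
  finally show ?thesis .
qed

lemma prime_dvd_prime_power_diff_one:
  fixes x :: "'a :: comm_ring_1"
  assumes "prime p"
  shows "of_nat p dvd x ^ (p ^ k) - 1 - (x - 1) ^ (p ^ k)"
proof (induction k)
  case (Suc k)
  define y where "y = x ^ (p ^ k)"
  have "of_nat p dvd (y - 1) ^ p - ((x - 1) ^ (p ^ k)) ^ p"
    using Suc by (subst power_diff_sumr2) (auto simp: y_def intro: dvd_mult2)
  hence "of_nat p dvd (y ^ p - 1 - (y - 1) ^ p) + ((y - 1) ^ p - ((x - 1) ^ (p ^ k)) ^ p)"
    by (rule dvd_add[OF prime_dvd_power_diff_one[OF assms]])
  also have "(y ^ p - 1 - (y - 1) ^ p) + ((y - 1) ^ p - ((x - 1) ^ (p ^ k)) ^ p) = y ^ p - 1 - ((x - 1) ^ (p ^ k)) ^ p"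
    by simp
  finally show ?case
    by (simp add: y_def mult.commute flip: power_mult)
qed simp

lemma not_prime_power_cases:
  fixes N :: nat
  assumes "N > 1"
  shows "(\<exists>p k. prime p \<and> N = p ^ Suc k) \<or> (\<exists>a b. N = a * b \<and> coprime a b \<and> a > 1 \<and> b > 1)"
proof -
  obtain p where p: "prime p" "p dvd N" using prime_factor_nat[of N] assms by auto
  obtain m where m: "N = p ^ multiplicity p N * m" "\<not> p dvd m"
    using multiplicity_decompose'[of N p] p assms by (metis less_numeral_extra(1) not_prime_unit not_less_zero)
  have mult: "multiplicity p N > 0"
    using p assms by (simp add: prime_multiplicity_gt_zero_iff)
  show ?thesis
  proof (cases "m = 1")
    case True
    thus ?thesis using m mult p by (metis Suc_pred mult.right_neutral)
  next
    case False
    have "m > 1" using m assms False by (cases m) auto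
    moreover have "coprime (p ^ multiplicity p N) m"
      using m(2) p(1) by (simp add: prime_imp_coprime)
    moreover have "p ^ multiplicity p N > 1"
      using p mult by (metis one_less_power prime_gt_1_nat)
    ultimately show ?thesis using m by blast
  qed
qed

lemma monom_minus_1_factor:
  "monom (1::int) (a * b) - 1 = (monom 1 a - 1) * (\<Sum>j<b. monom 1 (a * j))"
  using power_diff_1_eq[of "monom (1::int) a" b] by (simp add: monom_power)

text \<open>
  Modulo \<open>g\<close>, the element \<open>x - 1\<close> is a unit since \<open>g(1) = 1\<close>, but its \<open>p\<^sup>k\<close>-th power is divisible
  by \<open>p\<close>. So \<open>p\<close> would be a unit modulo the monic polynomial \<open>g\<close>.
\<close>

lemma dvd_monom_prime_power_minus_1_imp_degree_0:
  fixes g :: "int poly"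
  assumes p: "prime p" and lc: "\<bar>lead_coeff g\<bar> = 1" and g1: "poly g 1 = 1"
    and dvd: "g dvd monom 1 (p ^ k) - 1"
  shows "degree g = 0"
proof (rule ccontr)
  assume deg: "degree g \<noteq> 0"
  define X where "X = (monom 1 1 :: int poly)"
  define N where "N = p ^ k"
  obtain B where B: "X ^ N - 1 - (X - 1) ^ N = of_nat p * B"
    using prime_dvd_prime_power_diff_one[OF p, of X k] by (auto simp: N_def)
  have "g dvd X ^ N - 1" using dvd by (simp add: X_def N_def monom_power)
  hence gB: "g dvd (X - 1) ^ N + of_nat p * B" by (simp flip: B)
  have "[:-1, 1:] dvd g - 1" by (subst poly_eq_0_iff_dvd[symmetric]) (simp add: g1)
  then obtain s where s: "g - 1 = (X - 1) * s"
    by (auto simp: X_def monom_Suc monom_0 one_pCons elim!: dvdE)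
  \<comment> \<open>Modulo \<open>g\<close> the polynomial \<open>s\<close> is minus an inverse of X
    - 1; multiplying by s^N turns the power of X - 1 into (-1)^N.\<close>
  have "g dvd s ^ N * ((X - 1) ^ N + of_nat p * B)" using gB by simp
  also have "s ^ N * ((X - 1) ^ N + of_nat p * B) = (g - 1) ^ N + of_nat p * (s ^ N * B)"
    by (simp add: s power_mult_distrib distrib_left mult_ac)
  finally have 1: "g dvd (g - 1) ^ N + of_nat p * (s ^ N * B)" .
  have "g - 1 - (-1) dvd (g - 1) ^ N - (-1) ^ N"
    by (subst power_diff_sumr2) (rule dvd_triv_left)
  hence "g dvd (g - 1) ^ N - (-1) ^ N" by simp
  from dvd_diff[OF 1 this] have "g dvd (-1) ^ N + of_nat p * (s ^ N * B)"
    by (simp add: algebra_simps)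
  then obtain D where D: "(-1) ^ N + of_nat p * (s ^ N * B) = g * D" by (elim dvdE)
  \<comment> \<open>By \<open>D\<close>, the product \<open>g * D\<close> is (-1)^N plus a multiple
    of p, so only its constant coefficient can escape divisibility by p.\<close>
  have cgD: "int p dvd coeff (g * D) i" if "i > 0" for i
    using that by (simp flip: D) (cases "even N"; simp add: of_nat_poly)
  define J where "J = {j. \<not> int p dvd coeff D j}"
  have finJ: "finite J" unfolding J_def
    by (rule finite_subset[of _ "{..degree D}"]) (auto intro: le_degree)
  show False
  proof (cases "J = {}")
    case True
    hence "[:int p:] dvd D" by (simp add: J_def const_poly_dvd_iff)
    hence "[:int p:] dvd g * D" by simp
    hence "[:int p:] dvd (-1) ^ N + of_nat p * (s ^ N * B)" by (simp add: D)
    moreover have "[:int p:] dvd of_nat p * (s ^ N * B)" by (metis dvd_triv_left of_nat_poly)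
    ultimately have "[:int p:] dvd (-1) ^ N" using dvd_add_left_iff by blast
    hence "[:int p:] dvd 1" by (cases "even N") auto
    thus False using p by (simp add: is_unit_const_poly_iff)
  next
    case False
    \<comment> \<open>Gauss's argument: j is the highest index at which \<open>D\<close> is nonzero
      modulo p. In degree \<open>degree g + j\<close> the product has, modulo p, the coefficient
      \<open>lead_coeff g\<close> times that of \<open>D\<close> at j. It is not divisible by p,
      although the degree is positive.\<close>
    define j where "j = Max J"
    have j: "\<not> int p dvd coeff D j" using Max_in[OF finJ False] by (simp add: j_def J_def)
    have j': "int p dvd coeff D i" if "i > j" for i
      using Max_ge[OF finJ, of i] that by (auto simp: j_def J_def)
    have "coeff (g * D) (degree g + j) = (\<Sum>i\<le>degree g + j. coeff g i * coeff D (degree g + j - i))"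
      by (simp add: coeff_mult)
    also have "\<dots> = lead_coeff g * coeff D j + (\<Sum>i\<in>{..degree g + j} - {degree g}. coeff g i * coeff D (degree g + j - i))"
      by (subst sum.remove[of _ "degree g"]) auto
    finally have e: "coeff (g * D) (degree g + j) = \<dots>" .
    have "int p dvd (\<Sum>i\<in>{..degree g + j} - {degree g}. coeff g i * coeff D (degree g + j - i))"
    proof (rule dvd_sum)
      fix i assume i: "i \<in> {..degree g + j} - {degree g}"
      show "int p dvd coeff g i * coeff D (degree g + j - i)"
      proof (cases "i < degree g")
        case True
        thus ?thesis by (intro dvd_mult j') auto
      next
        case False
        thus ?thesis using i by (simp add: coeff_eq_0)
      qed
    qed
    moreover have "int p dvd coeff (g * D) (degree g + j)" using deg by (intro cgD) auto
    ultimately have "int p dvd lead_coeff g * coeff D j" by (simp add: e dvd_add_left_iff)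
    moreover have "lead_coeff g = 1 \<or> lead_coeff g = -1" using lc by linarith
    ultimately show False using j by auto
  qed
qed

text \<open>The cyclotomic polynomial of order N > 1 takes at 1 the value p if N is a power of the
  prime p, and the value 1 otherwise; the two alternatives mirror this dichotomy.\<close>

lemma unimodular_irreducible_cases:
  fixes h :: "int poly"
  assumes irr: "irreducible (map_poly rat_of_int h)"
    and h0: "poly h 0 = 1" and h1: "poly h 1 > 0"
    and roots: "\<And>z::complex. poly (map_poly of_int h) z = 0 \<Longrightarrow> cmod z = 1"
  shows "poly h 1 = 1 \<or> (\<exists>p k. prime p \<and> h = (\<Sum>j<p. monom 1 (p ^ k * j)))"
proof -
  \<comment> \<open>The product of the roots has modulus 1, and up to sign it is h(0) divided by the
    leading coefficient.\<close>
  have "cmod (of_int (lead_coeff h)) = cmod (of_int (poly h 0))"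
    using norm_lead_coeff_if_unimodular_roots[of "map_poly of_int h"] roots poly_map_poly_of_int[of h 0, where 'a=complex]
    by (simp add: degree_map_poly_of_int coeff_map_poly)
  hence lc: "\<bar>lead_coeff h\<bar> = 1" using h0 by simp
  have pr: "prime_elem h"
    using irreducible_int_poly_if_rat[OF irr lc] by (rule irreducible_imp_prime_elem)
  define P where "P N \<longleftrightarrow> N > 0 \<and> h dvd monom 1 N - 1" for N
  define N where "N = (LEAST N. P N)"
  have "\<exists>N. P N" using unimodular_int_poly_dvd_root_of_unity[OF irr h0 lc roots] by (auto simp: P_def)
  hence N: "P N" unfolding N_def by (rule LeastI_ex)
  have Nmin: "\<not> P a" if "a < N" for a using that not_less_Least unfolding N_def by blast
  have cofactor: "h dvd (\<Sum>j<b. monom 1 (a * j))" if "N = a * b" "a < N" "a > 0" for a b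
  proof -
    have "h dvd (monom 1 a - 1) * (\<Sum>j<b. monom 1 (a * j))"
      using N that(1) by (simp add: P_def monom_minus_1_factor)
    moreover have "\<not> h dvd monom 1 a - 1" using Nmin[OF that(2)] that(3) by (simp add: P_def)
    ultimately show ?thesis using pr by (simp add: prime_elem_dvd_mult_iff)
  qed
  have val: "poly h 1 dvd int b" if d: "h dvd (\<Sum>j<b. monom 1 (a * j))" for a b
  proof -
    obtain q where "(\<Sum>j<b. monom 1 (a * j)) = h * q" using d by (elim dvdE)
    from arg_cong[OF this, of "\<lambda>p. poly p 1"] show ?thesis by (simp add: poly_sum poly_monom)
  qed
  \<comment> \<open>For N = 1 we would have x - 1 = h q; since h(1) is nonzero, q absorbs the factor
    x - 1 and \<open>h\<close> becomes a unit.\<close>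
  have "N \<noteq> 1"
  proof
    assume "N = 1"
    then obtain q where q: "monom 1 1 - 1 = h * q" using N by (auto simp: P_def elim: dvdE)
    from arg_cong[OF this, of "\<lambda>p. poly p 1"] have "poly q 1 = 0"
      using h1 by (simp add: poly_monom)
    then obtain r where r: "q = [:-1, 1:] * r" by (auto simp: poly_eq_0_iff_dvd elim: dvdE)
    have "[:-1, 1:] * 1 = [:-1, 1:] * (h * r)"
      using q by (simp add: r monom_Suc monom_0 one_pCons algebra_simps)
    hence "1 = h * r" by (subst (asm) mult_left_cancel) auto
    thus False using pr by (metis dvd_triv_left prime_elem_not_unit)
  qed
  hence "N > 1" using N by (simp add: P_def)
  from not_prime_power_cases[OF this] show ?thesis
  proof (elim disjE exE conjE)
    fix a b assume ab: "N = a * b" "coprime a b" "a > 1" "b > 1"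
    have "poly h 1 dvd int a" by (rule val[OF cofactor[of b a]]) (use ab in auto)
    moreover have "poly h 1 dvd int b" by (rule val[OF cofactor[of a b]]) (use ab in auto)
    moreover have "coprime (int a) (int b)" using ab by simp
    ultimately have "poly h 1 dvd 1" by (rule coprime_common_divisor[rotated])
    thus ?thesis using h1 by simp
  next
    fix p k assume p: "prime p" "N = p ^ Suc k"
    have pp: "p > 1" using p prime_gt_1_nat by blast
    have "h dvd (\<Sum>j<p. monom 1 (p ^ k * j))" by (rule cofactor) (use p pp in auto)
    then obtain g where g: "(\<Sum>j<p. monom 1 (p ^ k * j)) = h * g" by (elim dvdE)
    have "int p = poly h 1 * poly g 1"
      using arg_cong[OF g, of "\<lambda>p. poly p 1"] by (simp add: poly_sum poly_monom)
    moreover have "prime (int p)" using p by simp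
    ultimately have "poly h 1 = 1 \<or> poly g 1 = 1"
    proof -
      have "nat (poly h 1) * nat (poly g 1) = p"
        using \<open>int p = _\<close> h1 by (metis nat_int nat_mult_distrib less_imp_le)
      hence "nat (poly h 1) = 1 \<or> nat (poly g 1) = 1" using p(1) prime_product by blast
      thus ?thesis by linarith
    qed
    \<comment> \<open>As a divisor of x^N - 1 the cofactor has leading coefficient 1 or -1; with
      value 1 at 1 and N a prime power it must be constant.\<close>
    moreover have "g = 1" if g1: "poly g 1 = 1"
    proof -
      have NN: "(monom 1 (p ^ k) - 1) * (h * g) = monom 1 N - 1"
        unfolding g[symmetric] using monom_minus_1_factor[of "p ^ k" p] p by (simp add: mult.commute)
      have "degree (monom (1::int) N - 1) = N" 
        using \<open>N > 1\<close> by (intro antisym degree_diff_le le_degree) (auto simp: degree_monom_eq coeff_1)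
      hence "lead_coeff (monom (1::int) N - 1) = 1" using \<open>N > 1\<close> by simp
      hence "lead_coeff ((monom 1 (p ^ k) - 1) * h) * lead_coeff g = 1"
        by (simp only: NN[symmetric] lead_coeff_mult mult.assoc)
      hence lcg: "\<bar>lead_coeff g\<bar> = 1" by (metis abs_mult abs_one abs_zmult_eq_1 mult.commute)
      have "degree g = 0"
        by (rule dvd_monom_prime_power_minus_1_imp_degree_0[OF p(1) lcg g1, of "Suc k"])
          (metis NN p(2) dvd_triv_right mult.assoc)
      thus "g = 1" using g1 by (elim degree_eq_zeroE) (simp add: one_pCons)
    qed
    ultimately show ?thesis using p(1) g by (metis mult.right_neutral)
  qed
qed

subsection \<open>Power series with denominators \<open>(1 - x)^d\<close>\<close>

lemma fps_nth_mult_one_minus_X: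
  fixes f :: "'a :: comm_ring_1 fps"
  shows "(f * (1 - fps_X)) $ 0 = f $ 0" "(f * (1 - fps_X)) $ Suc i = f $ Suc i - f $ i"
  by (simp_all add: algebra_simps)

text \<open>Division by 1 - x is partial summation. After one division the coefficients are
  eventually constant with value P(1), and partial sums of integers that are eventually at most -1
  again end up at most -1. The exponent starts at 1 because the coefficients of \<open>P\<close>
  itself are eventually 0.\<close>

lemma eventually_neg_if_numerator_neg:
  fixes f :: "int fps"
  assumes "f * (1 - fps_X) ^ Suc d = fps_of_poly P" "poly P 1 < 0"
  shows "\<exists>n0. \<forall>i\<ge>n0. f $ i \<le> -1"
  using assms(1)
proof (induction d arbitrary: f)
  case 0
  have s: "f $ i = (\<Sum>j\<le>i. coeff P j)" for i
  proof (induction i)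
    case 0
    have "f $ 0 = (f * (1 - fps_X)) $ 0" by simp
    also have "\<dots> = coeff P 0" using \<open>f * _ = _\<close> by simp
    finally show ?case by simp
  next
    case (Suc i)
    thus ?case using fps_nth_mult_one_minus_X(2)[of f i] \<open>f * _ = _\<close> by simp
  qed
  have "f $ i = poly P 1" if "i \<ge> degree P" for i
  proof -
    have "(\<Sum>j\<le>i. coeff P j) = (\<Sum>j\<le>degree P. coeff P j)"
      using that by (intro sum.mono_neutral_right) (auto intro: coeff_eq_0)
    thus ?thesis by (simp add: s poly_altdef)
  qed
  thus ?case using assms(2) by (intro exI[of _ "degree P"]) auto
next
  case (Suc d)
  define g where "g = f * (1 - fps_X)"
  have "g * (1 - fps_X) ^ Suc d = fps_of_poly P" using Suc.prems by (simp add: g_def mult.assoc)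
  from Suc.IH[OF this] obtain n0 where n0: "\<And>i. i \<ge> n0 \<Longrightarrow> g $ i \<le> -1" by blast
  have step: "f $ (n0 + k) \<le> f $ n0 - int k" for k
  proof (induction k)
    case (Suc k)
    have "g $ Suc (n0 + k) = f $ Suc (n0 + k) - f $ (n0 + k)"
      unfolding g_def by (rule fps_nth_mult_one_minus_X)
    moreover have "g $ Suc (n0 + k) \<le> -1" by (rule n0) simp
    ultimately show ?case using Suc by simp
  qed simp
  show ?case
  proof (intro exI[of _ "n0 + nat (f $ n0 + 1)"] allI impI)
    fix i assume "i \<ge> n0 + nat (f $ n0 + 1)"
    then obtain k where "i = n0 + k" "k \<ge> nat (f $ n0 + 1)"
      by (metis add_le_cancel_left le_Suc_ex le_add1 le_trans)
    moreover have "f $ (n0 + k) \<le> -1" using step[of k] \<open>k \<ge> _\<close> by linarith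
    ultimately show "f $ i \<le> -1" by simp
  qed
qed

text \<open>Without a denominator P(1) is the sum of the coefficients of \<open>f\<close>; otherwise
  a negative P(1) makes them eventually negative. Inequalities between Hilbert functions become
  statements about numerators through this lemma.\<close>

lemma numerator_at_1_nonneg:
  fixes f :: "int fps"
  assumes f: "f * (1 - fps_X) ^ d = fps_of_poly P" and nonneg: "\<And>i. f $ i \<ge> 0"
  shows "poly P 1 \<ge> 0"
proof (cases d)
  case 0
  hence "f = fps_of_poly P" using f by simp
  hence "coeff P i \<ge> 0" for i using nonneg[of i] by simp
  thus ?thesis by (auto simp: poly_altdef intro: sum_nonneg)
next
  case (Suc k)
  show ?thesis
  proof (rule ccontr)
    assume "\<not> poly P 1 \<ge> 0"
    then obtain n0 where "\<forall>i\<ge>n0. f $ i \<le> -1"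
      using eventually_neg_if_numerator_neg[of f k P] f Suc by auto
    thus False using nonneg[of n0] by force
  qed
qed

subsection \<open>Counting exponent vectors\<close>

lemma weighted_degree_altdef:
  assumes "finite V" "Poly_Mapping.keys a \<subseteq> V"
  shows "weighted_degree w a = (\<Sum>i\<in>V. w i * Poly_Mapping.lookup a i)"
  unfolding weighted_degree_def using assms
  by (intro sum.mono_neutral_left) (auto simp: in_keys_iff)

lemma weighted_degree_add: "weighted_degree w (a + b) = weighted_degree w a + weighted_degree w b"
proof -
  let ?V = "Poly_Mapping.keys a \<union> Poly_Mapping.keys b"
  have "finite ?V" "Poly_Mapping.keys (a + b) \<subseteq> ?V"
    using Poly_Mapping.keys_add[of a b] by auto
  thus ?thesis
    by (simp add: weighted_degree_altdef[of ?V] lookup_add algebra_simps sum.distrib)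
qed

lemma weighted_degree_single: "weighted_degree w (Poly_Mapping.single v k) = w v * k"
  by (simp add: weighted_degree_def)

lemma weighted_degree_0: "weighted_degree w 0 = 0"
  by (simp add: weighted_degree_def)

lemma keys_add_nat:
  "Poly_Mapping.keys (a + b :: nat \<Rightarrow>\<^sub>0 nat) = Poly_Mapping.keys a \<union> Poly_Mapping.keys b"
  by (auto simp: in_keys_iff lookup_add)

text \<open>\<open>V\<close> is any set of variables, since the coordinate cones of subsets are
  counted as well; the weights allow generators of arbitrary degree.\<close>

definition exponents :: "nat set \<Rightarrow> (nat \<Rightarrow> nat) \<Rightarrow> nat \<Rightarrow> (nat \<Rightarrow>\<^sub>0 nat) set" where
  "exponents V w i = {a. Poly_Mapping.keys a \<subseteq> V \<and> weighted_degree w a = i}"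

lemma finite_bounded_exponents:
  assumes "finite V"
  shows "finite {a :: nat \<Rightarrow>\<^sub>0 nat. Poly_Mapping.keys a \<subseteq> V \<and> (\<forall>j. Poly_Mapping.lookup a j \<le> b)}" (is "finite ?S")
proof -
  have "Poly_Mapping.lookup ` ?S \<subseteq> {f. \<forall>x. (x \<in> V \<longrightarrow> f x \<in> {..b}) \<and> (x \<notin> V \<longrightarrow> f x = 0)}"
    by (auto simp: in_keys_iff subset_iff)
  moreover have "finite {f. \<forall>x. (x \<in> V \<longrightarrow> f x \<in> {..b}) \<and> (x \<notin> V \<longrightarrow> f x = (0::nat))}"
    using assms by (intro finite_set_of_finite_funs) auto
  ultimately have "finite (Poly_Mapping.lookup ` ?S)" by (rule finite_subset)
  thus ?thesis by (rule finite_imageD) (auto intro!: inj_onI poly_mapping_eqI)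
qed

lemma finite_exponents:
  assumes "finite V" "\<And>v. v \<in> V \<Longrightarrow> w v > 0"
  shows "finite (exponents V w i)"
proof (rule finite_subset[OF _ finite_bounded_exponents[OF assms(1), of i]], clarify)
  fix a assume "a \<in> exponents V w i"
  hence a: "Poly_Mapping.keys a \<subseteq> V" "weighted_degree w a = i" by (auto simp: exponents_def)
  show "Poly_Mapping.keys a \<subseteq> V \<and> (\<forall>j. Poly_Mapping.lookup a j \<le> i)"
  proof (intro conjI allI)
    fix j show "Poly_Mapping.lookup a j \<le> i"
    proof (cases "j \<in> V")
      case True
      have "Poly_Mapping.lookup a j \<le> w j * Poly_Mapping.lookup a j" using assms(2)[OF True] by simp
      also have "\<dots> \<le> (\<Sum>i\<in>V. w i * Poly_Mapping.lookup a i)"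
        using True assms(1) by (intro member_le_sum) auto
      also have "\<dots> = i" using a assms(1) by (simp add: weighted_degree_altdef)
      finally show ?thesis .
    next
      case False
      hence "Poly_Mapping.lookup a j = 0" using a by (meson in_keys_iff subsetD)
      thus ?thesis by simp
    qed
  qed (use a in auto)
qed

text \<open>An exponent vector avoids v, or one copy of v can be removed, which lowers the degree by
  \<open>w v\<close>. For the generating series F with v and G without v this reads F = G + x^(w v)
  F.\<close>

lemma exponents_insert:
  assumes "v \<notin> V"
  shows "exponents (insert v V) w i = exponents V w i \<union>
    (if w v \<le> i then (\<lambda>a. a + Poly_Mapping.single v 1) ` exponents (insert v V) w (i - w v) else {})"
    (is "?L = ?R")
proof (intro equalityI subsetI)
  fix a assume a: "a \<in> ?L"
  show "a \<in> ?R"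
  proof (cases "v \<in> Poly_Mapping.keys a")
    case False
    thus ?thesis using a by (auto simp: exponents_def)
  next
    case True
    define b where "b = a - Poly_Mapping.single v 1"
    have ab: "a = b + Poly_Mapping.single v 1"
      using True by (intro poly_mapping_eqI) (auto simp: b_def lookup_add lookup_minus lookup_single when_def in_keys_iff)
    have "Poly_Mapping.keys b \<subseteq> insert v V" "weighted_degree w b + w v = i"
      using a by (auto simp: exponents_def ab keys_add_nat weighted_degree_add weighted_degree_single)
    thus ?thesis unfolding ab by (auto simp: exponents_def)
  qed
next
  fix a assume "a \<in> ?R"
  thus "a \<in> ?L"
    by (auto simp: exponents_def keys_add_nat weighted_degree_add weighted_degree_single split: if_splits)
qed

text \<open>The Hilbert series of the polynomial ring in the variables \<open>V\<close>.\<close>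

definition exponent_series :: "nat set \<Rightarrow> (nat \<Rightarrow> nat) \<Rightarrow> int fps" where
  "exponent_series V w = Abs_fps (\<lambda>i. int (card (exponents V w i)))"

lemma exponent_series_mult:
  assumes "finite V" "\<And>v. v \<in> V \<Longrightarrow> w v > 0"
  shows "exponent_series V w * (\<Prod>v\<in>V. 1 - fps_X ^ w v) = 1"
  using assms
proof (induction V rule: finite_induct)
  case empty
  have "exponents {} w i = (if i = 0 then {0} else {})" for i
    by (auto simp: exponents_def weighted_degree_0)
  thus ?case by (intro fps_ext) (simp add: exponent_series_def)
next
  case (insert v V)
  have fin: "finite (exponents V w i)" "finite (exponents (insert v V) w i)" for i
    using insert.prems insert.hyps by (auto intro!: finite_exponents)
  have "exponent_series (insert v V) w = exponent_series V w + fps_X ^ w v * exponent_series (insert v V) w"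
  proof (rule fps_ext)
    fix i
    have disj: "exponents V w i \<inter> (\<lambda>a. a + Poly_Mapping.single v 1) ` exponents (insert v V) w (i - w v) = {}"
      using insert.hyps(2) by (auto simp: exponents_def keys_add_nat)
    have "card (exponents (insert v V) w i) = card (exponents V w i) + (if w v \<le> i then card (exponents (insert v V) w (i - w v)) else 0)"
      by (subst exponents_insert[OF insert.hyps(2)])
         (use fin disj in \<open>auto simp: card_Un_disjoint card_image\<close>)
    thus "exponent_series (insert v V) w $ i = (exponent_series V w + fps_X ^ w v * exponent_series (insert v V) w) $ i"
      by (auto simp: exponent_series_def fps_X_power_mult_nth)
  qed
  hence "exponent_series (insert v V) w * (1 - fps_X ^ w v) = exponent_series V w"
    by (simp add: algebra_simps)
  thus ?case using insert by (simp flip: mult.assoc)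
qed

lemma exponent_series_one:
  assumes "finite V"
  shows "exponent_series V (\<lambda>_. 1) * (1 - fps_X) ^ card V = 1"
  using exponent_series_mult[OF assms, of "\<lambda>_. 1"] by simp

subsection \<open>Order ideals of exponent vectors\<close>

text \<open>Suppose that each set A of d variables carries a monomial \<open>c A\<close> outside
  \<open>M\<close>. Then a member of \<open>M\<close> has large exponents in fewer than d variables,
  as it would otherwise be a multiple of some \<open>c A\<close>. Hence \<open>M\<close> is covered
  by finitely many translates of coordinate cones of dimension less than d, whose series have poles
  of order less than d.\<close>

lemma order_ideal_contains_coordinate_cone:
  fixes M :: "(nat \<Rightarrow>\<^sub>0 nat) set" and h :: "int poly"
  assumes V: "finite V" and MV: "\<And>a. a \<in> M \<Longrightarrow> Poly_Mapping.keys a \<subseteq> V"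
    and down: "\<And>a b. a + b \<in> M \<Longrightarrow> a \<in> M" and zero: "0 \<in> M"
    and series: "Abs_fps (\<lambda>i. int (card {a \<in> M. weighted_degree (\<lambda>_. 1) a = i})) * (1 - fps_X) ^ d = fps_of_poly h"
    and h1: "poly h 1 \<noteq> 0"
  shows "\<exists>A\<subseteq>V. card A = d \<and> {a. Poly_Mapping.keys a \<subseteq> A} \<subseteq> M"
proof (cases d)
  case 0
  thus ?thesis using zero by (intro exI[of _ "{}"]) auto
next
  case (Suc d')
  let ?deg = "weighted_degree (\<lambda>_. 1)"
  define H where "H = Abs_fps (\<lambda>i. int (card {a \<in> M. ?deg a = i}))"
  have "poly h 1 \<ge> 0"
    by (rule numerator_at_1_nonneg[OF series]) simp
  hence h1: "poly h 1 > 0" using h1 by simp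
  show ?thesis
  proof (rule ccontr)
    assume "\<not> ?thesis"
    hence "\<forall>A. \<exists>a. A \<subseteq> V \<and> card A = d \<longrightarrow> Poly_Mapping.keys a \<subseteq> A \<and> a \<notin> M" by blast
    then obtain c where c: "\<And>A. A \<subseteq> V \<Longrightarrow> card A = d \<Longrightarrow> Poly_Mapping.keys (c A) \<subseteq> A \<and> c A \<notin> M" by metis
    \<comment> \<open>An exponent counts as large if it exceeds \<open>b\<close>, which bounds all
      exponents of all \<open>c A\<close>.\<close>
    define b where "b = (\<Sum>A\<in>Pow V. \<Sum>j\<in>V. Poly_Mapping.lookup (c A) j)"
    have b: "Poly_Mapping.lookup (c A) j \<le> b" if "A \<subseteq> V" "j \<in> V" for A j
    proof -
      have "Poly_Mapping.lookup (c A) j \<le> (\<Sum>j\<in>V. Poly_Mapping.lookup (c A) j)"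
        using that V by (intro member_le_sum) auto
      also have "\<dots> \<le> b" unfolding b_def using that V by (intro member_le_sum) auto
      finally show ?thesis .
    qed
    define Box where "Box = {a :: nat \<Rightarrow>\<^sub>0 nat. Poly_Mapping.keys a \<subseteq> V \<and> (\<forall>j. Poly_Mapping.lookup a j \<le> b)}"
    define S where "S = {B. B \<subseteq> V \<and> card B < d} \<times> Box"
    have finS: "finite S" unfolding S_def Box_def using V finite_bounded_exponents[OF V, of b] by auto
    \<comment> \<open>The degree i part of the translated cone \<open>e + v\<close> with v supported
      on \<open>B\<close>; the case distinction guards the truncated subtraction.\<close>
    define C where "C i = (\<lambda>(B, e). if ?deg e \<le> i then (\<lambda>v. e + v) ` exponents B (\<lambda>_. 1) (i - ?deg e) else {})" for i
    have cover: "{a \<in> M. ?deg a = i} \<subseteq> (\<Union>s\<in>S. C i s)" for i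
    proof
      fix u assume u: "u \<in> {a \<in> M. ?deg a = i}"
      define B where "B = {j \<in> V. Poly_Mapping.lookup u j > b}"
      have BV: "B \<subseteq> V" by (auto simp: B_def)
      have "card B < d"
      proof (rule ccontr)
        assume "\<not> card B < d"
        then obtain A where A: "A \<subseteq> B" "card A = d" by (metis linorder_not_less obtain_subset_with_card_n)
        hence AV: "A \<subseteq> V" using BV by auto
        have "Poly_Mapping.lookup (c A) j \<le> Poly_Mapping.lookup u j" for j
        proof (cases "j \<in> A")
          case True
          hence "j \<in> B" "j \<in> V" using A AV by auto
          thus ?thesis using b[OF AV, of j] by (auto simp: B_def)
        next
          case False
          hence "Poly_Mapping.lookup (c A) j = 0" using c[OF AV A(2)] by (meson in_keys_iff subsetD)
          thus ?thesis by simp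
        qed
        hence "u = c A + (u - c A)"
          by (intro poly_mapping_eqI) (simp add: lookup_add lookup_minus)
        hence "c A \<in> M" using u down[of "c A" "u - c A"] by simp
        thus False using c[OF AV A(2)] by simp
      qed
      have lookB: "Poly_Mapping.lookup (Abs_poly_mapping (\<lambda>j. if P j then Poly_Mapping.lookup u j else 0)) j = (if P j then Poly_Mapping.lookup u j else 0)" for P j
        by (subst lookup_Abs_poly_mapping) (auto intro: finite_subset[OF _ finite_lookup[of u]])
      define v where "v = Abs_poly_mapping (\<lambda>j. if j \<in> B then Poly_Mapping.lookup u j else 0)"
      define e where "e = Abs_poly_mapping (\<lambda>j. if j \<notin> B then Poly_Mapping.lookup u j else 0)"
      have ev: "u = e + v" by (intro poly_mapping_eqI) (simp add: lookup_add e_def v_def lookB)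
      have kv: "Poly_Mapping.keys v \<subseteq> B" by (auto simp: in_keys_iff v_def lookB split: if_splits)
      have uV: "Poly_Mapping.keys u \<subseteq> V" using u MV by auto
      have "Poly_Mapping.lookup e j \<le> b" for j
      proof (cases "j \<in> V")
        case True
        thus ?thesis by (simp add: e_def lookB B_def)
      next
        case False
        hence "Poly_Mapping.lookup u j = 0" using uV by (meson in_keys_iff subsetD)
        thus ?thesis by (simp add: e_def lookB)
      qed
      moreover have "Poly_Mapping.keys e \<subseteq> V"
        using uV by (auto simp: e_def lookB in_keys_iff subset_iff split: if_splits)
      ultimately have "e \<in> Box" by (simp add: Box_def)
      hence "(B, e) \<in> S" using BV \<open>card B < d\<close> by (auto simp: S_def)
      moreover have "u \<in> C i (B, e)"
        using u kv by (auto simp: C_def ev weighted_degree_add exponents_def)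
      ultimately show "u \<in> (\<Union>s\<in>S. C i s)" by blast
    qed
    define F where "F = (\<Sum>(B, e)\<in>S. fps_X ^ ?deg e * exponent_series B (\<lambda>_. 1))"
    have finB: "finite B" if "(B, e) \<in> S" for B e using that V finite_subset by (auto simp: S_def)
    have le: "H $ i \<le> F $ i" for i
    proof -
      have finC: "finite (C i s)" if "s \<in> S" for s
        using that finB by (auto simp: C_def split: prod.splits intro!: finite_imageI finite_exponents)
      have "card {a \<in> M. ?deg a = i} \<le> card (\<Union>s\<in>S. C i s)"
        using cover finS finC by (intro card_mono) auto
      also have "\<dots> \<le> (\<Sum>s\<in>S. card (C i s))" by (rule card_UN_le[OF finS])
      finally have "H $ i \<le> (\<Sum>s\<in>S. int (card (C i s)))" by (simp add: H_def flip: of_nat_sum)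
      also have "\<dots> = F $ i"
        unfolding F_def fps_sum_nth
        by (rule sum.cong) (auto simp: C_def fps_X_power_mult_nth exponent_series_def card_image)
      finally show ?thesis .
    qed
    \<comment> \<open>All terms are brought over (1 - x)^d' with d' = d - 1, which is possible
      because each \<open>B\<close> has at most d' elements.\<close>
    define Q where "Q = (\<Sum>(B, e)\<in>S. monom (1::int) (?deg e) * [:1, -1:] ^ (d' - card B))"
    have "F * (1 - fps_X) ^ d' = (\<Sum>(B, e)\<in>S. fps_X ^ ?deg e * (1 - fps_X) ^ (d' - card B))"
      unfolding F_def sum_distrib_right
    proof (rule sum.cong, rule refl, clarify)
      fix B e assume s: "(B, e) \<in> S"
      hence "card B \<le> d'" by (auto simp: S_def Suc)
      hence "(1 - fps_X :: int fps) ^ d' = (1 - fps_X) ^ card B * (1 - fps_X) ^ (d' - card B)"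
        by (simp flip: power_add)
      hence "fps_X ^ ?deg e * exponent_series B (\<lambda>_. 1) * (1 - fps_X) ^ d' =
          fps_X ^ ?deg e * (exponent_series B (\<lambda>_. 1) * (1 - fps_X) ^ card B) * (1 - fps_X) ^ (d' - card B)"
        by (simp only: mult.assoc)
      thus "fps_X ^ ?deg e * exponent_series B (\<lambda>_. 1) * (1 - fps_X) ^ d' = fps_X ^ ?deg e * (1 - fps_X) ^ (d' - card B)"
        by (simp only: exponent_series_one[OF finB[OF s]] mult_1_right)
    qed
    also have "\<dots> = fps_of_poly Q"
      unfolding Q_def fps_of_poly_sum
      by (rule sum.cong) (auto simp: fps_of_poly_mult fps_of_poly_power fps_of_poly_monom' fps_of_poly_pCons fps_const_neg[symmetric])
    finally have "F * (1 - fps_X) ^ d' = fps_of_poly Q" .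
    moreover have "H * (1 - fps_X) ^ d = fps_of_poly h" using series by (simp only: H_def)
    moreover have "fps_of_poly [:1, -1:] = (1 - fps_X :: int fps)"
      by (simp add: fps_of_poly_pCons fps_const_neg[symmetric])
    \<comment> \<open>The spare factor 1 - x kills \<open>Q\<close> at 1, so the numerator of F - H
      has the value -h(1) < 0 there although F dominates H.\<close>
    ultimately have "(F - H) * (1 - fps_X) ^ d = fps_of_poly (Q * [:1, -1:] - h)"
      by (simp only: left_diff_distrib fps_of_poly_diff fps_of_poly_mult Suc power_Suc2 flip: mult.assoc)
    hence "poly (Q * [:1, -1:] - h) 1 \<ge> 0"
      by (rule numerator_at_1_nonneg) (use le in simp)
    thus False using h1 by simp
  qed
qed

subsection \<open>Linear algebra\<close>

context vector_space_pair
begin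

text \<open>Rank-nullity for the map from \<open>U\<close> to the quotient of the target by
  \<open>A\<close>, whose image is (A + f(U))/A, without forming the quotient. Linearity is asked on
  \<open>U\<close> only, because the isomorphism of a complete intersection is controlled only on
  polynomials in its n variables.\<close>

lemma dim_plus_image:
  assumes U: "vs1.subspace U" "finite TU" "U \<subseteq> vs1.span TU"
    and A: "vs2.subspace A" "finite TA" "A \<subseteq> vs2.span TA"
    and add: "\<And>x y. x \<in> U \<Longrightarrow> y \<in> U \<Longrightarrow> f (x + y) = f x + f y"
    and scale: "\<And>c x. x \<in> U \<Longrightarrow> f (s1 c x) = s2 c (f x)"
  shows "vs2.dim {a + f u | a u. a \<in> A \<and> u \<in> U} + vs1.dim {u \<in> U. f u \<in> A} = vs2.dim A + vs1.dim U"
proof -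
  let ?K = "{u \<in> U. f u \<in> A}" and ?S = "{a + f u | a u. a \<in> A \<and> u \<in> U}"
  have f0: "f 0 = 0"
    using scale[of 0 0] vs1.subspace_0[OF U(1)] by simp
  have fsum: "f (\<Sum>x\<in>X. s1 (c x) x) = (\<Sum>x\<in>X. s2 (c x) (f x))" if "finite X" "X \<subseteq> U" for c X
    using that
  proof (induction X rule: finite_induct)
    case (insert x X)
    have "s1 (c x) x \<in> U" "(\<Sum>x\<in>X. s1 (c x) x) \<in> U"
      using insert.prems U(1) by (auto intro!: vs1.subspace_scale vs1.subspace_sum)
    thus ?case using insert add scale by simp
  qed (simp add: f0)
  obtain B1 where B1: "B1 \<subseteq> ?K" "vs1.independent B1" "?K \<subseteq> vs1.span B1" "card B1 = vs1.dim ?K"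
    using vs1.basis_exists by blast
  obtain B2 where B2: "B1 \<subseteq> B2" "B2 \<subseteq> U" "vs1.independent B2" "U \<subseteq> vs1.span B2"
    using vs1.maximal_independent_subset_extend[of B1 U] B1 by blast
  obtain B0 where B0: "B0 \<subseteq> A" "vs2.independent B0" "A \<subseteq> vs2.span B0" "card B0 = vs2.dim A"
    using vs2.basis_exists by blast
  have fin2: "finite B2" using vs1.independent_span_bound[OF U(2) B2(3)] B2(2) U(3) by auto
  have fin0: "finite B0" using vs2.independent_span_bound[OF A(2) B0(2)] B0(1) A(3) by auto
  have fin1: "finite B1" using fin2 B2(1) finite_subset by blast
  have dimU: "card B2 = vs1.dim U" using vs1.basis_card_eq_dim[OF B2(2,4,3)] .
  define C where "C = B2 - B1"
  have finC: "finite C" and CU: "C \<subseteq> U" using fin2 B2 by (auto simp: C_def)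
  \<comment> \<open>\<open>C\<close> completes a basis of the kernel to a basis of \<open>U\<close>;
    the claim is that \<open>f\<close> maps it to a family independent modulo \<open>A\<close>. A
    relation modulo \<open>A\<close> puts a combination of \<open>C\<close> into the span of
    \<open>B1\<close>, hence gives a relation on \<open>B2\<close>.\<close>
  have key: "c x = 0" if "(\<Sum>x\<in>C. s2 (c x) (f x)) \<in> A" "x \<in> C" for c x
  proof -
    let ?u = "\<Sum>x\<in>C. s1 (c x) x"
    have "?u \<in> U" using CU U(1) by (auto intro!: vs1.subspace_scale vs1.subspace_sum)
    moreover have "f ?u \<in> A" using that(1) by (simp add: fsum[OF finC CU])
    ultimately have "?u \<in> vs1.span B1" using B1(3) by blast
    then obtain d where d: "?u = (\<Sum>y\<in>B1. s1 (d y) y)"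
      using vs1.span_finite[OF fin1] by auto
    define e where "e y = (if y \<in> C then c y else - d y)" for y
    have "(\<Sum>y\<in>B2. s1 (e y) y) = (\<Sum>y\<in>C. s1 (e y) y) + (\<Sum>y\<in>B1. s1 (e y) y)"
      using sum.subset_diff[OF B2(1) fin2, of "\<lambda>y. s1 (e y) y"] by (simp add: C_def)
    also have "(\<Sum>y\<in>C. s1 (e y) y) = ?u" by (rule sum.cong) (auto simp: e_def)
    also have "(\<Sum>y\<in>B1. s1 (e y) y) = (\<Sum>y\<in>B1. - s1 (d y) y)"
      by (rule sum.cong) (auto simp: e_def C_def)
    also have "\<dots> = - ?u" by (simp add: d sum_negf)
    finally have "(\<Sum>y\<in>B2. s1 (e y) y) = 0" by simp
    hence "e x = 0" using B2(3) fin2 that(2) unfolding vs1.dependent_finite[OF fin2] C_def by blast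
    thus ?thesis using that(2) by (simp add: e_def)
  qed
  have inj: "inj_on f C"
  proof (rule inj_onI, rule ccontr)
    fix x y assume xy: "x \<in> C" "y \<in> C" "f x = f y" "x \<noteq> y"
    define c where "c z = (if z = x then 1 else if z = y then - 1 else (0::'a))" for z
    have "(\<Sum>z\<in>C. s2 (c z) (f z)) = (\<Sum>z\<in>{x,y}. s2 (c z) (f z))"
      using xy finC by (intro sum.mono_neutral_right) (auto simp: c_def)
    also have "\<dots> = 0" using xy by (simp add: c_def)
    finally have "c x = 0" using vs2.subspace_0[OF A(1)] by (intro key) (auto simp: xy)
    thus False by (simp add: c_def)
  qed
  have disj: "B0 \<inter> f ` C = {}"
  proof (rule ccontr)
    assume "B0 \<inter> f ` C \<noteq> {}"
    then obtain x where x: "x \<in> C" "f x \<in> B0" by auto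
    define c where "c z = (if z = x then 1 else (0::'a))" for z
    have "(\<Sum>z\<in>C. s2 (c z) (f z)) = (\<Sum>z\<in>{x}. s2 (c z) (f z))"
      using x finC by (intro sum.mono_neutral_right) (auto simp: c_def)
    also have "\<dots> = f x" by (simp add: c_def)
    finally have "c x = 0" using x B0(1) by (intro key) auto
    thus False by (simp add: c_def)
  qed
  have fin: "finite (B0 \<union> f ` C)" using fin0 finC by simp
  have split: "(\<Sum>y\<in>B0 \<union> f ` C. s2 (c y) y) = (\<Sum>y\<in>B0. s2 (c y) y) + (\<Sum>x\<in>C. s2 (c (f x)) (f x))" for c
    using fin0 finC disj inj by (simp add: sum.union_disjoint sum.reindex)
  have sumB0: "(\<Sum>y\<in>B0. s2 (c y) y) \<in> A" for c
    using B0(1) A(1) by (auto intro!: vs2.subspace_scale vs2.subspace_sum)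
  have "vs2.independent (B0 \<union> f ` C)"
    unfolding vs2.dependent_finite[OF fin]
  proof (rule notI, elim exE conjE bexE)
    fix c v assume v: "v \<in> B0 \<union> f ` C" "c v \<noteq> 0" and z: "(\<Sum>y\<in>B0 \<union> f ` C. s2 (c y) y) = 0"
    have "(\<Sum>x\<in>C. s2 (c (f x)) (f x)) = - (\<Sum>y\<in>B0. s2 (c y) y)"
      using z by (simp add: split eq_neg_iff_add_eq_0 add.commute)
    also have "\<dots> \<in> A" by (intro vs2.subspace_neg A(1) sumB0)
    finally have "\<And>x. x \<in> C \<Longrightarrow> c (f x) = 0" by (rule key)
    with z have "(\<Sum>y\<in>B0. s2 (c y) y) = 0" by (simp add: split)
    hence "\<And>y. y \<in> B0 \<Longrightarrow> c y = 0" using B0(2) unfolding vs2.dependent_finite[OF fin0] by blast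
    with \<open>\<And>x. x \<in> C \<Longrightarrow> c (f x) = 0\<close> v show False by auto
  qed
  moreover have "B0 \<union> f ` C \<subseteq> ?S"
  proof -
    have "b \<in> ?S" if "b \<in> B0" for b
      using that B0(1) vs1.subspace_0[OF U(1)] f0 by (intro CollectI exI[of _ b] exI[of _ 0]) auto
    moreover have "f x \<in> ?S" if "x \<in> C" for x
      using that CU vs2.subspace_0[OF A(1)] by (intro CollectI exI[of _ 0] exI[of _ x]) auto
    ultimately show ?thesis by blast
  qed
  moreover have "?S \<subseteq> vs2.span (B0 \<union> f ` C)"
  proof clarify
    fix a u assume a: "a \<in> A" and u: "u \<in> U"
    obtain d where d: "u = (\<Sum>y\<in>B2. s1 (d y) y)"
      using u B2(4) vs1.span_finite[OF fin2] by auto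
    have "f u = (\<Sum>y\<in>B2. s2 (d y) (f y))" unfolding d by (rule fsum[OF fin2 B2(2)])
    also have "\<dots> = (\<Sum>y\<in>C. s2 (d y) (f y)) + (\<Sum>y\<in>B1. s2 (d y) (f y))"
      using sum.subset_diff[OF B2(1) fin2, of "\<lambda>y. s2 (d y) (f y)"] by (simp add: C_def)
    finally have fu: "a + f u = (a + (\<Sum>y\<in>B1. s2 (d y) (f y))) + (\<Sum>y\<in>C. s2 (d y) (f y))"
      by (simp add: algebra_simps)
    have "a + (\<Sum>y\<in>B1. s2 (d y) (f y)) \<in> A"
      using a B1(1) A(1) by (auto intro!: vs2.subspace_add vs2.subspace_scale vs2.subspace_sum)
    hence "a + (\<Sum>y\<in>B1. s2 (d y) (f y)) \<in> vs2.span (B0 \<union> f ` C)"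
      using B0(3) vs2.span_mono[of B0 "B0 \<union> f ` C"] by blast
    moreover have "(\<Sum>y\<in>C. s2 (d y) (f y)) \<in> vs2.span (B0 \<union> f ` C)"
      by (intro vs2.span_sum vs2.span_scale vs2.span_base) auto
    ultimately show "a + f u \<in> vs2.span (B0 \<union> f ` C)"
      unfolding fu by (rule vs2.span_add)
  qed
  ultimately have "card (B0 \<union> f ` C) = vs2.dim ?S" by (intro vs2.basis_card_eq_dim)
  moreover have "card (B0 \<union> f ` C) = card B0 + (card B2 - card B1)"
    using fin0 finC disj inj fin1 B2(1) by (simp add: card_Un_disjoint card_image C_def card_Diff_subset)
  moreover have "card B1 \<le> card B2" using B2(1) fin2 by (rule card_mono[rotated])
  ultimately show ?thesis using B0(4) B1(4) dimU by simp
qed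

lemma rank_nullity:
  assumes U: "vs1.subspace U" "finite TU" "U \<subseteq> vs1.span TU"
    and add: "\<And>x y. x \<in> U \<Longrightarrow> y \<in> U \<Longrightarrow> f (x + y) = f x + f y"
    and scale: "\<And>c x. x \<in> U \<Longrightarrow> f (s1 c x) = s2 c (f x)"
  shows "vs2.dim (f ` U) + vs1.dim {u \<in> U. f u = 0} = vs1.dim U"
proof -
  have "vs2.dim {0} = 0"
    using vs2.dim_le_card[of "{0}" "{}"] by simp
  moreover have "{a + f u | a u. a \<in> {0} \<and> u \<in> U} = f ` U" by auto
  ultimately show ?thesis
    using dim_plus_image[OF U, of "{0}" "{}" f] add scale by (simp add: vs2.subspace_def)
qed

end

context vector_space
begin

lemma subspace_dim_eq:
  assumes "subspace S" "S \<subseteq> T" "dim S = dim T" "finite X" "T \<subseteq> span X"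
  shows "S = T"
proof -
  obtain B where B: "B \<subseteq> S" "independent B" "S \<subseteq> span B" "card B = dim S"
    using basis_exists by blast
  obtain B' where B': "B \<subseteq> B'" "B' \<subseteq> T" "independent B'" "T \<subseteq> span B'"
    using maximal_independent_subset_extend[of B T] B assms(2) by blast
  have "finite B'" using independent_span_bound[OF assms(4) B'(3)] B'(2) assms(5) by auto
  moreover have "card B' = dim T" by (rule basis_card_eq_dim[OF B'(2,4,3)])
  ultimately have "B = B'" using B'(1) B(4) assms(3) by (simp add: card_subset_eq)
  hence "T \<subseteq> S" using B' B(1) assms(1) span_minimal by blast
  thus ?thesis using assms(2) by blast
qed

text \<open>Greedy selection of a basis. Testing a vector against all its predecessors, and not only
  against the selected ones, gives the same spans but a condition that can be transported along
  multiplication by a monomial.\<close>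

lemma basis_of_linearly_ordered_family:
  fixes v :: "'i :: linorder \<Rightarrow> 'b"
  assumes "finite F"
  defines "J \<equiv> {a \<in> F. v a \<notin> span (v ` {b \<in> F. b < a})}"
  shows "inj_on v J" "independent (v ` J)" "span (v ` J) = span (v ` F)"
proof -
  have "inj_on v {a \<in> F. v a \<notin> span (v ` {b \<in> F. b < a})} \<and>
        independent (v ` {a \<in> F. v a \<notin> span (v ` {b \<in> F. b < a})}) \<and>
        span (v ` {a \<in> F. v a \<notin> span (v ` {b \<in> F. b < a})}) = span (v ` F)"
    using assms(1)
  proof (induction F rule: finite_linorder_max_induct)
    case (insert b A)
    define J where "J = {a \<in> A. v a \<notin> span (v ` {b \<in> A. b < a})}"
    have IH: "inj_on v J" "independent (v ` J)" "span (v ` J) = span (v ` A)"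
      using insert.IH by (auto simp: J_def)
    have "{c \<in> insert b A. c < a} = {c \<in> A. c < a}" if "a \<in> A" for a
      using insert.hyps(2) that by auto
    moreover have "{c \<in> insert b A. c < b} = A" using insert.hyps(2) by auto
    ultimately have eq: "{a \<in> insert b A. v a \<notin> span (v ` {c \<in> insert b A. c < a})} =
        (if v b \<in> span (v ` A) then J else insert b J)"
      using insert.hyps(2) by (auto simp: J_def)
    have bJ: "b \<notin> J" using insert.hyps(2) by (auto simp: J_def)
    show ?case
    proof (cases "v b \<in> span (v ` A)")
      case True
      thus ?thesis unfolding eq using IH by (simp add: span_redundant)
    next
      case False
      hence "v b \<notin> span (v ` J)" by (simp add: IH)
      moreover from this have "v b \<notin> v ` J" using span_base by blast
      moreover have "span (insert (v b) (v ` J)) = span (insert (v b) (v ` A))"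
        using IH(3) by (simp add: span_insert)
      ultimately show ?thesis unfolding eq using IH False bJ
        by (simp add: independent_insertI)
    qed
  qed (simp add: independent_empty)
  thus "inj_on v J" "independent (v ` J)" "span (v ` J) = span (v ` F)"
    by (auto simp: J_def)
qed

end

subsection \<open>Homogeneous components of polynomials\<close>

lemma mpoly_sum_monomials:
  "(p :: 'k :: field mpoly) = (\<Sum>a\<in>Poly_Mapping.keys p. Poly_Mapping.single a (Poly_Mapping.lookup p a))"
proof (rule poly_mapping_eqI)
  fix b
  have "Poly_Mapping.lookup (\<Sum>a\<in>Poly_Mapping.keys p. Poly_Mapping.single a (Poly_Mapping.lookup p a)) b =
      (\<Sum>a\<in>Poly_Mapping.keys p. if b = a then Poly_Mapping.lookup p b else 0)"
    unfolding lookup_sum by (rule sum.cong) (auto simp: lookup_single when_def)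
  thus "Poly_Mapping.lookup p b = Poly_Mapping.lookup (\<Sum>a\<in>Poly_Mapping.keys p. Poly_Mapping.single a (Poly_Mapping.lookup p a)) b"
    by (simp add: in_keys_iff)
qed

lemma lookup_mpoly_const_mult:
  "Poly_Mapping.lookup (mpoly_const c * p) a = c * Poly_Mapping.lookup p a"
  unfolding mpoly_const_def mult_map_scale_conv_mult[symmetric]
  by (simp add: Poly_Mapping.map.rep_eq when_def)

lemma vector_space_mpoly: "vector_space (\<lambda>c p. mpoly_const c * (p :: 'k :: field mpoly))"
  by unfold_locales
    (rule poly_mapping_eqI; simp only: lookup_mpoly_const_mult lookup_add distrib_left distrib_right mult.assoc mult_1)+

interpretation mp: vector_space "\<lambda>c p. mpoly_const c * (p :: 'k :: field mpoly)"
  by (rule vector_space_mpoly)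

lemma mpoly_ring_0: "0 \<in> mpoly_ring n"
  and mpoly_ring_1: "1 \<in> mpoly_ring n"
  and mpoly_ring_const: "mpoly_const c \<in> mpoly_ring n"
  by (auto simp: mpoly_ring_def mpoly_const_def)

lemma mpoly_ring_add: "p \<in> mpoly_ring n \<Longrightarrow> q \<in> mpoly_ring n \<Longrightarrow> p + q \<in> mpoly_ring n"
  using Poly_Mapping.keys_add[of p q] by (auto simp: mpoly_ring_def)

lemma mpoly_ring_uminus: "p \<in> mpoly_ring n \<Longrightarrow> - p \<in> mpoly_ring n"
  by (auto simp: mpoly_ring_def)

lemma mpoly_ring_mult:
  assumes "p \<in> mpoly_ring n" "q \<in> mpoly_ring n"
  shows "p * q \<in> mpoly_ring n"
  unfolding mpoly_ring_def
proof (clarify)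
  fix m i assume m: "m \<in> Poly_Mapping.keys (p * q)" "i \<in> Poly_Mapping.keys m"
  obtain a b where "m = a + b" "a \<in> Poly_Mapping.keys p" "b \<in> Poly_Mapping.keys q"
    using m keys_mult[of p q] by blast
  thus "i < n" using assms m(2) by (auto simp: mpoly_ring_def keys_add_nat)
qed

lemma mpoly_ring_sum: "(\<And>x. x \<in> A \<Longrightarrow> f x \<in> mpoly_ring n) \<Longrightarrow> sum f A \<in> mpoly_ring n"
  by (induction A rule: infinite_finite_induct) (auto intro: mpoly_ring_add mpoly_ring_0)

definition homogeneous_component :: "(nat \<Rightarrow> nat) \<Rightarrow> nat \<Rightarrow> 'k::field mpoly \<Rightarrow> 'k mpoly" where
  "homogeneous_component w i p = Abs_poly_mapping (\<lambda>a. if weighted_degree w a = i then Poly_Mapping.lookup p a else 0)"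

lemma lookup_homogeneous_component:
  "Poly_Mapping.lookup (homogeneous_component w i p) a = (if weighted_degree w a = i then Poly_Mapping.lookup p a else 0)"
  unfolding homogeneous_component_def
  by (subst lookup_Abs_poly_mapping) (auto intro: finite_subset[OF _ finite_lookup[of p]])

lemma homogeneous_component_add:
  "homogeneous_component w i (p + q) = homogeneous_component w i p + homogeneous_component w i q"
  by (rule poly_mapping_eqI) (simp add: lookup_homogeneous_component lookup_add)

lemma homogeneous_component_0: "homogeneous_component w i 0 = 0"
  by (rule poly_mapping_eqI) (simp add: lookup_homogeneous_component)

lemma homogeneous_component_sum:
  "homogeneous_component w i (sum f A) = (\<Sum>x\<in>A. homogeneous_component w i (f x))"
  by (induction A rule: infinite_finite_induct)
     (auto simp: homogeneous_component_add homogeneous_component_0)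

lemma mpoly_homogeneous_component: "mpoly_homogeneous w i (homogeneous_component w i p)"
  by (auto simp: mpoly_homogeneous_def in_keys_iff lookup_homogeneous_component split: if_splits)

lemma homogeneous_component_in_mpoly_ring: "p \<in> mpoly_ring n \<Longrightarrow> homogeneous_component w i p \<in> mpoly_ring n"
  by (auto simp: mpoly_ring_def in_keys_iff lookup_homogeneous_component split: if_splits)

lemma homogeneous_component_of_homogeneous:
  assumes "mpoly_homogeneous w e p"
  shows "homogeneous_component w i p = (if i = e then p else 0)"
  using assms
  by (intro poly_mapping_eqI) (auto simp: lookup_homogeneous_component mpoly_homogeneous_def in_keys_iff)

lemma sum_homogeneous_components:
  "(\<Sum>i\<in>weighted_degree w ` Poly_Mapping.keys p. homogeneous_component w i p) = p"
proof (rule poly_mapping_eqI)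
  fix a
  have "Poly_Mapping.lookup (\<Sum>i\<in>weighted_degree w ` Poly_Mapping.keys p. homogeneous_component w i p) a
      = (\<Sum>i\<in>weighted_degree w ` Poly_Mapping.keys p. if weighted_degree w a = i then Poly_Mapping.lookup p a else 0)"
    by (simp add: lookup_sum lookup_homogeneous_component)
  also have "\<dots> = (if weighted_degree w a \<in> weighted_degree w ` Poly_Mapping.keys p then Poly_Mapping.lookup p a else 0)"
    by simp
  also have "\<dots> = Poly_Mapping.lookup p a"
    by (auto simp: in_keys_iff)
  finally show "Poly_Mapping.lookup (\<Sum>i\<in>weighted_degree w ` Poly_Mapping.keys p. homogeneous_component w i p) a = Poly_Mapping.lookup p a" .
qed

lemma mpoly_homogeneous_mult:
  assumes "mpoly_homogeneous w i p" "mpoly_homogeneous w j q"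
  shows "mpoly_homogeneous w (i + j) (p * q)"
  unfolding mpoly_homogeneous_def
proof
  fix m assume m: "m \<in> Poly_Mapping.keys (p * q)"
  obtain a b where "m = a + b" "a \<in> Poly_Mapping.keys p" "b \<in> Poly_Mapping.keys q"
    using m keys_mult[of p q] by blast
  thus "weighted_degree w m = i + j"
    using assms by (auto simp: mpoly_homogeneous_def weighted_degree_add)
qed

lemma mpoly_homogeneous_add:
  "mpoly_homogeneous w i p \<Longrightarrow> mpoly_homogeneous w i q \<Longrightarrow> mpoly_homogeneous w i (p + q)"
  using Poly_Mapping.keys_add[of p q] by (auto simp: mpoly_homogeneous_def)

lemma mpoly_homogeneous_0: "mpoly_homogeneous w i 0"
  by (simp add: mpoly_homogeneous_def)

lemma mpoly_homogeneous_const: "mpoly_homogeneous w 0 (mpoly_const c)"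
  by (simp add: mpoly_homogeneous_def mpoly_const_def weighted_degree_0)

lemma homogeneous_component_mult:
  assumes "mpoly_homogeneous w e f"
  shows "homogeneous_component w i (g * f) = (if e \<le> i then homogeneous_component w (i - e) g * f else 0)"
proof -
  let ?D = "weighted_degree w ` Poly_Mapping.keys g"
  have "homogeneous_component w i (g * f) = homogeneous_component w i ((\<Sum>j\<in>?D. homogeneous_component w j g) * f)"
    by (simp add: sum_homogeneous_components)
  also have "\<dots> = (\<Sum>j\<in>?D. homogeneous_component w i (homogeneous_component w j g * f))"
    by (simp add: sum_distrib_right homogeneous_component_sum)
  also have "\<dots> = (\<Sum>j\<in>?D. if i = j + e then homogeneous_component w j g * f else 0)"
    using homogeneous_component_of_homogeneous[OF mpoly_homogeneous_mult[OF mpoly_homogeneous_component assms], of i]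
    by simp
  also have "\<dots> = (if e \<le> i then (\<Sum>j\<in>?D. if i - e = j then homogeneous_component w j g * f else 0) else 0)"
  proof (cases "e \<le> i")
    case True
    hence "(i = j + e) = (i - e = j)" for j by auto
    thus ?thesis using True by (simp only: if_True)
  qed (auto intro: sum.neutral)
  also have "(\<Sum>j\<in>?D. if i - e = j then homogeneous_component w j g * f else 0) = homogeneous_component w (i - e) g * f"
  proof (cases "i - e \<in> ?D")
    case False
    hence "homogeneous_component w (i - e) g = 0"
      by (intro poly_mapping_eqI) (auto simp: lookup_homogeneous_component, metis image_eqI in_keys_iff)
    thus ?thesis using False by (simp add: sum.delta)
  qed (simp add: sum.delta)
  finally show ?thesis .
qed

definition graded_piece :: "nat \<Rightarrow> (nat \<Rightarrow> nat) \<Rightarrow> nat \<Rightarrow> 'k::field mpoly set" where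
  "graded_piece n w i = {p \<in> mpoly_ring n. mpoly_homogeneous w i p}"

lemma subspace_graded_piece: "mp.subspace (graded_piece n w i)"
  unfolding mp.subspace_def graded_piece_def
  using mpoly_homogeneous_mult[OF mpoly_homogeneous_const]
  by (auto intro: mpoly_ring_0 mpoly_ring_add mpoly_ring_mult mpoly_ring_const mpoly_homogeneous_add mpoly_homogeneous_0)

lemma graded_piece_mult:
  "p \<in> graded_piece n w i \<Longrightarrow> q \<in> graded_piece n w j \<Longrightarrow> p * q \<in> graded_piece n w (i + j)"
  by (auto simp: graded_piece_def intro: mpoly_ring_mult mpoly_homogeneous_mult)

lemma homogeneous_component_in_graded_piece:
  "p \<in> mpoly_ring n \<Longrightarrow> homogeneous_component w i p \<in> graded_piece n w i"
  by (simp add: graded_piece_def mpoly_homogeneous_component homogeneous_component_in_mpoly_ring)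

lemma mpoly_const_mult_single:
  "mpoly_const c * Poly_Mapping.single a d = Poly_Mapping.single a (c * d)"
  by (simp add: mpoly_const_def mult_single)

lemma graded_piece_basis:
  fixes n w i
  defines "B \<equiv> (\<lambda>a. Poly_Mapping.single a (1::'k::field)) ` exponents {..<n} w i"
  assumes w: "\<And>j. j < n \<Longrightarrow> w j > 0"
  shows "finite B" "B \<subseteq> graded_piece n w i" "graded_piece n w i \<subseteq> mp.span B"
    "mp.dim (graded_piece n w i :: 'k mpoly set) = card (exponents {..<n} w i)"
proof -
  let ?s = "\<lambda>a. Poly_Mapping.single a (1::'k)"
  have finE: "finite (exponents {..<n} w i)" using w by (intro finite_exponents) auto
  thus fin: "finite B" by (simp add: B_def)
  have inj: "inj_on ?s X" for X :: "(nat \<Rightarrow>\<^sub>0 nat) set" by (rule inj_onI) (metis keys_single one_neq_zero singleton_inject)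
  show sub: "B \<subseteq> graded_piece n w i"
    by (auto simp: B_def graded_piece_def mpoly_ring_def mpoly_homogeneous_def exponents_def)
  show span: "graded_piece n w i \<subseteq> mp.span B"
  proof
    fix p :: "'k mpoly" assume p: "p \<in> graded_piece n w i"
    have "p = (\<Sum>a\<in>Poly_Mapping.keys p. mpoly_const (Poly_Mapping.lookup p a) * ?s a)"
      by (subst mpoly_sum_monomials[of p]) (simp add: mpoly_const_mult_single)
    moreover have "Poly_Mapping.keys p \<subseteq> exponents {..<n} w i"
      using p by (auto simp: graded_piece_def mpoly_ring_def mpoly_homogeneous_def exponents_def)
    hence "(\<Sum>a\<in>Poly_Mapping.keys p. mpoly_const (Poly_Mapping.lookup p a) * ?s a) \<in> mp.span B"
      by (intro mp.span_sum mp.span_scale mp.span_base) (auto simp: B_def)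
    ultimately show "p \<in> mp.span B" by simp
  qed
  have "mp.independent B"
    unfolding mp.dependent_finite[OF fin]
  proof (rule notI, elim exE conjE bexE)
    fix c v assume v: "v \<in> B" "c v \<noteq> 0" and z: "(\<Sum>v\<in>B. mpoly_const (c v) * v) = 0"
    obtain a where a: "a \<in> exponents {..<n} w i" "v = ?s a" using v by (auto simp: B_def)
    have "0 = Poly_Mapping.lookup (\<Sum>v\<in>B. mpoly_const (c v) * v) a" by (simp only: z lookup_zero)
    also have "\<dots> = (\<Sum>b\<in>exponents {..<n} w i. if a = b then c (?s a) else 0)"
      unfolding B_def by (subst sum.reindex[OF inj])
        (auto simp: lookup_sum lookup_mpoly_const_mult lookup_single when_def intro!: sum.cong)
    also have "\<dots> = c v" using a finE by (simp add: sum.delta)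
    finally show False using v by simp
  qed
  hence "mp.dim (graded_piece n w i :: 'k mpoly set) = card B"
    using sub span by (metis mp.basis_card_eq_dim)
  also have "\<dots> = card (exponents {..<n} w i)" unfolding B_def by (rule card_image[OF inj])
  finally show "mp.dim (graded_piece n w i :: 'k mpoly set) = card (exponents {..<n} w i)" .
qed

subsection \<open>The Hilbert series of a complete intersection\<close>

lemma mpoly_ideal_Nil: "mpoly_ideal n [] = {0}"
  by (auto simp: mpoly_ideal_def intro: mpoly_ring_0)

text \<open>This recursion on the last generator follows the order in which a regular sequence grows
  and drives the inductions on ideals below.\<close>

lemma mpoly_ideal_snoc:
  "mpoly_ideal n (fs @ [f]) = {q + g * f | q g. q \<in> mpoly_ideal n fs \<and> g \<in> mpoly_ring n}"
proof (intro equalityI subsetI)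
  fix p assume "p \<in> mpoly_ideal n (fs @ [f])"
  then obtain g where g: "p = (\<Sum>j<Suc (length fs). g j * (fs @ [f]) ! j)" "\<forall>j<Suc (length fs). g j \<in> mpoly_ring n"
    by (auto simp: mpoly_ideal_def)
  have "p = (\<Sum>j<length fs. g j * fs ! j) + g (length fs) * f"
    by (simp add: g(1) nth_append)
  moreover have "(\<Sum>j<length fs. g j * fs ! j) \<in> mpoly_ideal n fs"
    using g(2) by (auto simp: mpoly_ideal_def)
  moreover have "g (length fs) \<in> mpoly_ring n" using g(2) by simp
  ultimately show "p \<in> {q + g * f | q g. q \<in> mpoly_ideal n fs \<and> g \<in> mpoly_ring n}" by blast
next
  fix p assume "p \<in> {q + g * f | q g. q \<in> mpoly_ideal n fs \<and> g \<in> mpoly_ring n}"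
  then obtain g c where g: "p = (\<Sum>j<length fs. g j * fs ! j) + c * f" "\<forall>j<length fs. g j \<in> mpoly_ring n" "c \<in> mpoly_ring n"
    by (auto simp: mpoly_ideal_def)
  define g' where "g' = g(length fs := c)"
  have "p = (\<Sum>j<length (fs @ [f]). g' j * (fs @ [f]) ! j)"
    by (simp add: g(1) nth_append g'_def)
  moreover have "\<forall>j<length (fs @ [f]). g' j \<in> mpoly_ring n"
    using g by (auto simp: g'_def less_Suc_eq)
  ultimately show "p \<in> mpoly_ideal n (fs @ [f])" by (auto simp: mpoly_ideal_def)
qed

lemma mpoly_ideal_snocI:
  "q \<in> mpoly_ideal n fs \<Longrightarrow> g \<in> mpoly_ring n \<Longrightarrow> q + g * f \<in> mpoly_ideal n (fs @ [f])"
  by (auto simp: mpoly_ideal_snoc)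

lemma mpoly_ideal_0: "0 \<in> mpoly_ideal n fs"
  by (induction fs rule: rev_induct)
     (auto simp: mpoly_ideal_Nil mpoly_ideal_snoc intro!: exI[of _ 0] mpoly_ring_0)

lemma mpoly_ideal_add: "p \<in> mpoly_ideal n fs \<Longrightarrow> q \<in> mpoly_ideal n fs \<Longrightarrow> p + q \<in> mpoly_ideal n fs"
proof (induction fs arbitrary: p q rule: rev_induct)
  case (snoc f fs)
  then obtain p' g q' g' where "p = p' + g * f" "q = q' + g' * f" "p' \<in> mpoly_ideal n fs" "q' \<in> mpoly_ideal n fs"
      "g \<in> mpoly_ring n" "g' \<in> mpoly_ring n"
    by (auto simp: mpoly_ideal_snoc)
  moreover from this have "p + q = (p' + q') + (g + g') * f" by (simp add: algebra_simps)
  ultimately show ?case using mpoly_ideal_snocI[OF snoc.IH mpoly_ring_add] by metis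
qed (simp add: mpoly_ideal_Nil)

lemma mpoly_ideal_mult: "p \<in> mpoly_ideal n fs \<Longrightarrow> c \<in> mpoly_ring n \<Longrightarrow> c * p \<in> mpoly_ideal n fs"
proof (induction fs arbitrary: p rule: rev_induct)
  case (snoc f fs)
  then obtain p' g where "p = p' + g * f" "p' \<in> mpoly_ideal n fs" "g \<in> mpoly_ring n"
    by (auto simp: mpoly_ideal_snoc)
  moreover from this have "c * p = c * p' + (c * g) * f" by (simp add: algebra_simps)
  ultimately show ?case using mpoly_ideal_snocI[OF snoc.IH mpoly_ring_mult] snoc.prems(2) by simp
qed (simp add: mpoly_ideal_Nil)

lemma mpoly_ideal_append: "mpoly_ideal n fs \<subseteq> mpoly_ideal n (fs @ gs)"
proof (induction gs rule: rev_induct)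
  case (snoc f gs)
  have "mpoly_ideal n (fs @ gs) \<subseteq> mpoly_ideal n ((fs @ gs) @ [f])"
    using mpoly_ideal_snocI[OF _ mpoly_ring_0] by fastforce
  also have "(fs @ gs) @ [f] = fs @ gs @ [f]" by simp
  finally show ?case using snoc by (rule order.trans[rotated])
qed simp

lemma mpoly_ideal_subset_ring: "set fs \<subseteq> mpoly_ring n \<Longrightarrow> mpoly_ideal n fs \<subseteq> mpoly_ring n"
  unfolding mpoly_ideal_def by (auto intro!: mpoly_ring_sum mpoly_ring_mult)

lemma subspace_mpoly_ideal: "mp.subspace (mpoly_ideal n fs)"
  unfolding mp.subspace_def by (auto intro: mpoly_ideal_0 mpoly_ideal_add mpoly_ideal_mult mpoly_ring_const)

lemma homogeneous_component_in_ideal: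
  assumes "\<forall>f\<in>set fs. \<exists>e. mpoly_homogeneous w e f" "p \<in> mpoly_ideal n fs"
  shows "homogeneous_component w i p \<in> mpoly_ideal n fs"
  using assms
proof (induction fs arbitrary: p rule: rev_induct)
  case (snoc f fs)
  obtain e where e: "mpoly_homogeneous w e f" using snoc.prems by auto
  obtain p' g where p: "p = p' + g * f" "p' \<in> mpoly_ideal n fs" "g \<in> mpoly_ring n"
    using snoc.prems by (auto simp: mpoly_ideal_snoc)
  have "homogeneous_component w i p' \<in> mpoly_ideal n fs"
    using snoc.IH snoc.prems(1) p by auto
  moreover have "homogeneous_component w i (g * f) = (if e \<le> i then homogeneous_component w (i - e) g else 0) * f"
    using homogeneous_component_mult[OF e] by auto
  moreover have "(if e \<le> i then homogeneous_component w (i - e) g else 0) \<in> mpoly_ring n"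
    using p by (auto intro: homogeneous_component_in_mpoly_ring mpoly_ring_0)
  ultimately show ?case using mpoly_ideal_snocI by (simp only: p(1) homogeneous_component_add)
qed (simp add: mpoly_ideal_Nil homogeneous_component_0)

text \<open>The Hilbert series of the quotient ring when the ideal is homogeneous, written as an
  integer difference so that no quotient space has to be formed.\<close>

definition quotient_series :: "nat \<Rightarrow> (nat \<Rightarrow> nat) \<Rightarrow> 'k::field mpoly list \<Rightarrow> int fps" where
  "quotient_series n w fs = Abs_fps (\<lambda>i. int (mp.dim (graded_piece n w i :: 'k mpoly set)) -
     int (mp.dim (mpoly_ideal n fs \<inter> graded_piece n w i)))"

lemma quotient_series_Nil:
  assumes "\<And>j. j < n \<Longrightarrow> w j > 0"
  shows "quotient_series n w ([] :: 'k::field mpoly list) = exponent_series {..<n} w"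
proof -
  have "mpoly_ideal n [] \<inter> graded_piece n w i = {0 :: 'k mpoly}" for i
    using mp.subspace_0[OF subspace_graded_piece[of n w i]] by (auto simp: mpoly_ideal_Nil)
  moreover have "mp.dim {0 :: 'k mpoly} = 0"
    using mp.dim_le_card[of "{0}" "{}"] by simp
  ultimately show ?thesis
    using graded_piece_basis(4)[OF assms, where 'k='k] by (simp add: quotient_series_def exponent_series_def)
qed

text \<open>In each degree this is the exact sequence 0 -> (S/I)(-e) -> S/I -> S/(I + (f)) -> 0
  whose first map is multiplication by \<open>f\<close>; regularity is its injectivity.\<close>

lemma quotient_series_snoc:
  fixes f :: "'k::field mpoly"
  assumes w: "\<And>j. j < n \<Longrightarrow> w j > 0"
    and hom: "\<forall>f\<in>set fs. \<exists>e. mpoly_homogeneous w e f"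
    and f: "f \<in> mpoly_ring n" "mpoly_homogeneous w e f"
    and reg: "\<And>g. g \<in> mpoly_ring n \<Longrightarrow> f * g \<in> mpoly_ideal n fs \<Longrightarrow> g \<in> mpoly_ideal n fs"
  shows "quotient_series n w (fs @ [f]) = quotient_series n w fs * (1 - fps_X ^ e)"
proof -
  interpret mm: vector_space_pair "\<lambda>c p. mpoly_const c * (p :: 'k mpoly)" "\<lambda>c p. mpoly_const c * (p :: 'k mpoly)" ..
  let ?U = "graded_piece n w :: nat \<Rightarrow> 'k mpoly set"
  let ?I = "\<lambda>fs i. mpoly_ideal n fs \<inter> ?U i"
  have low: "?I (fs @ [f]) i = ?I fs i" if "i < e" for i
  proof
    show "?I fs i \<subseteq> ?I (fs @ [f]) i" using mpoly_ideal_append by blast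
    show "?I (fs @ [f]) i \<subseteq> ?I fs i"
    proof
      fix p assume p: "p \<in> ?I (fs @ [f]) i"
      then obtain q g where q: "p = q + g * f" "q \<in> mpoly_ideal n fs" "g \<in> mpoly_ring n"
        by (auto simp: mpoly_ideal_snoc)
      have "p = homogeneous_component w i p"
        using p homogeneous_component_of_homogeneous[of w i p i] by (simp add: graded_piece_def)
      also have "\<dots> = homogeneous_component w i q"
        using that by (simp add: q(1) homogeneous_component_add homogeneous_component_mult[OF f(2)])
      finally show "p \<in> ?I fs i" using p homogeneous_component_in_ideal[OF hom q(2)] by auto
    qed
  qed
  have high: "?I (fs @ [f]) (i + e) = {a + u * f | a u. a \<in> ?I fs (i + e) \<and> u \<in> ?U i}" for i
  proof
    show "{a + u * f | a u. a \<in> ?I fs (i + e) \<and> u \<in> ?U i} \<subseteq> ?I (fs @ [f]) (i + e)"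
    proof clarify
      fix a u assume au: "a \<in> mpoly_ideal n fs" "a \<in> ?U (i + e)" "u \<in> ?U i"
      have "u * f \<in> ?U (i + e)" using au f by (intro graded_piece_mult) (auto simp: graded_piece_def)
      hence "a + u * f \<in> ?U (i + e)" using au mp.subspace_add[OF subspace_graded_piece] by blast
      thus "a + u * f \<in> ?I (fs @ [f]) (i + e)" using au by (auto simp: mpoly_ideal_snoc graded_piece_def)
    qed
    show "?I (fs @ [f]) (i + e) \<subseteq> {a + u * f | a u. a \<in> ?I fs (i + e) \<and> u \<in> ?U i}"
    proof
      fix p assume p: "p \<in> ?I (fs @ [f]) (i + e)"
      then obtain q g where q: "p = q + g * f" "q \<in> mpoly_ideal n fs" "g \<in> mpoly_ring n"
        by (auto simp: mpoly_ideal_snoc)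
      have "p = homogeneous_component w (i + e) p"
        using p homogeneous_component_of_homogeneous[of w "i + e" p "i + e"] by (simp add: graded_piece_def)
      also have "\<dots> = homogeneous_component w (i + e) q + homogeneous_component w i g * f"
        by (simp add: q(1) homogeneous_component_add homogeneous_component_mult[OF f(2)])
      finally have pe: "p = \<dots>" .
      have u: "homogeneous_component w i g \<in> ?U i" using q by (intro homogeneous_component_in_graded_piece)
      hence "homogeneous_component w i g * f \<in> ?U (i + e)" using f by (intro graded_piece_mult) (auto simp: graded_piece_def)
      hence "homogeneous_component w (i + e) q \<in> ?U (i + e)"
        using pe p mp.subspace_diff[OF subspace_graded_piece, of p n w "i + e" "homogeneous_component w i g * f"]
        by (simp add: algebra_simps)
      thus "p \<in> {a + u * f | a u. a \<in> ?I fs (i + e) \<and> u \<in> ?U i}"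
        using pe u homogeneous_component_in_ideal[OF hom q(2)] by blast
    qed
  qed
  \<comment> \<open>The dimension formula for A + U f with A the degree i + e part of the old ideal;
    by regularity, the forms u of degree i with u f in A are the degree i part of the old
    ideal.\<close>
  have main: "mp.dim (?I (fs @ [f]) (i + e)) + mp.dim (?I fs i) = mp.dim (?I fs (i + e)) + mp.dim (?U i)" for i
  proof -
    have "{u \<in> ?U i. u * f \<in> ?I fs (i + e)} = ?I fs i"
    proof (intro equalityI subsetI)
      fix u assume "u \<in> {u \<in> ?U i. u * f \<in> ?I fs (i + e)}"
      thus "u \<in> ?I fs i" using reg[of u] by (auto simp: graded_piece_def mult.commute)
    next
      fix u assume u: "u \<in> ?I fs i"
      hence "u * f \<in> ?U (i + e)" using f by (intro graded_piece_mult) (auto simp: graded_piece_def)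
      moreover have "f * u \<in> mpoly_ideal n fs" using u f by (intro mpoly_ideal_mult) auto
      ultimately show "u \<in> {u \<in> ?U i. u * f \<in> ?I fs (i + e)}" using u by (auto simp: mult.commute)
    qed
    moreover have "mp.subspace (?I fs (i + e))"
      by (intro mp.subspace_inter subspace_mpoly_ideal subspace_graded_piece)
    moreover note basis = graded_piece_basis[where n = n and w = w and 'k = 'k, OF w]
    have "?I fs (i + e) \<subseteq> mp.span ((\<lambda>a. Poly_Mapping.single a 1) ` exponents {..<n} w (i + e))"
      using basis(3)[of "i + e"] by blast
    ultimately have "mp.dim {a + u * f | a u. a \<in> ?I fs (i + e) \<and> u \<in> ?U i} + mp.dim {u \<in> ?U i. u * f \<in> ?I fs (i + e)} =
        mp.dim (?I fs (i + e)) + mp.dim (?U i)"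
      using mm.dim_plus_image[OF subspace_graded_piece[of n w i] basis(1,3)[of i], of "?I fs (i + e)" _ "\<lambda>u. u * f"] basis(1)[of "i + e"]
      by (simp add: distrib_right mult.assoc)
    thus ?thesis
      by (simp only: high \<open>{u \<in> ?U i. u * f \<in> ?I fs (i + e)} = ?I fs i\<close>)
  qed
  show ?thesis
  proof (rule fps_ext)
    fix i
    have "quotient_series n w (fs @ [f]) $ i = quotient_series n w fs $ i - (if e \<le> i then quotient_series n w fs $ (i - e) else 0)"
    proof (cases "e \<le> i")
      case False
      thus ?thesis using low[of i] by (simp add: quotient_series_def)
    next
      case True
      thus ?thesis using main[of "i - e"] by (simp add: quotient_series_def)
    qed
    thus "quotient_series n w (fs @ [f]) $ i = (quotient_series n w fs * (1 - fps_X ^ e)) $ i"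
      by (simp add: right_diff_distrib mult.commute[of _ "fps_X ^ e"] fps_X_power_mult_nth)
  qed
qed

text \<open>With positive weights a form of degree 0 is a constant. A nonzero constant generates the
  whole ring, and 0 is a nonzerodivisor only modulo the whole ring; both contradict properness.
  Positivity matters because a factor 1 - x^0 = 0 would make the product formula void.\<close>

lemma regular_sequence_degree_pos:
  assumes reg: "regular_sequence n fs" and w: "\<And>j. j < n \<Longrightarrow> w j > 0"
    and k: "k < length fs" and hom: "mpoly_homogeneous w e (fs ! k)"
  shows "e > 0"
proof (rule ccontr)
  assume "\<not> e > 0"
  hence e: "e = 0" by simp
  define f where "f = fs ! k"
  have one: "1 \<notin> mpoly_ideal n fs"
  proof
    assume "1 \<in> mpoly_ideal n fs"
    hence "mpoly_ring n \<subseteq> mpoly_ideal n fs" using mpoly_ideal_mult[of 1 n fs] by force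
    moreover have "mpoly_ideal n fs \<subseteq> mpoly_ring n"
      using reg by (intro mpoly_ideal_subset_ring) (auto simp: regular_sequence_def)
    ultimately show False using reg by (auto simp: regular_sequence_def)
  qed
  have "set fs \<subseteq> mpoly_ring n" using reg by (simp add: regular_sequence_def)
  hence fr: "f \<in> mpoly_ring n" using k by (auto simp: f_def)
  have sub: "mpoly_ideal n (take j fs) \<subseteq> mpoly_ideal n fs" for j
    using mpoly_ideal_append[of n "take j fs" "drop j fs"] by simp
  have "a = 0" if "a \<in> Poly_Mapping.keys f" for a
  proof -
    have "weighted_degree w a = 0" using hom that by (auto simp: mpoly_homogeneous_def f_def e)
    have "Poly_Mapping.keys a \<subseteq> {..<n}" using fr that by (auto simp: mpoly_ring_def)
    have "Poly_Mapping.lookup a i = 0" for i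
    proof (cases "i \<in> Poly_Mapping.keys a")
      case True
      hence "w i * Poly_Mapping.lookup a i = 0"
        using \<open>weighted_degree w a = 0\<close> by (simp add: weighted_degree_def)
      moreover have "w i > 0" using True \<open>Poly_Mapping.keys a \<subseteq> {..<n}\<close> by (intro w) auto
      ultimately show ?thesis by simp
    qed (simp add: in_keys_iff)
    thus "a = 0" by (intro poly_mapping_eqI) simp
  qed
  hence fc: "f = mpoly_const (Poly_Mapping.lookup f 0)"
    by (intro poly_mapping_eqI) (auto simp: mpoly_const_def lookup_single when_def in_keys_iff)
  have "Poly_Mapping.lookup f 0 \<noteq> 0"
  proof
    assume "Poly_Mapping.lookup f 0 = 0"
    hence "f = 0" using fc by (simp add: mpoly_const_def)
    hence "fs ! k * 1 \<in> mpoly_ideal n (take k fs)" by (simp add: f_def mpoly_ideal_0)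
    hence "1 \<in> mpoly_ideal n (take k fs)" using reg k mpoly_ring_1 unfolding regular_sequence_def by blast
    thus False using sub one by blast
  qed
  hence "mpoly_const (1 / Poly_Mapping.lookup f 0) * f = 1"
    by (subst fc) (simp add: mpoly_const_def mult_single)
  moreover have "mpoly_const (1 / Poly_Mapping.lookup f 0) * f \<in> mpoly_ideal n (take (Suc k) fs)"
    unfolding take_Suc_conv_app_nth[OF k] mpoly_ideal_snoc f_def[symmetric]
    using mpoly_ideal_0 mpoly_ring_const by (metis (mono_tags, lifting) add.left_neutral mem_Collect_eq)
  ultimately show False using sub one by (metis subsetD)
qed

lemma quotient_series_regular_sequence:
  fixes fs :: "'k::field mpoly list"
  assumes reg: "regular_sequence n fs" and w: "\<And>j. j < n \<Longrightarrow> w j > 0"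
    and hom: "\<forall>f\<in>set fs. \<exists>e. mpoly_homogeneous w e f"
  shows "\<exists>e. (\<forall>k<length fs. e k > 0) \<and>
    quotient_series n w fs * (\<Prod>j<n. 1 - fps_X ^ w j) = (\<Prod>k<length fs. 1 - fps_X ^ e k)"
proof -
  from hom have "\<forall>k<length fs. \<exists>e. mpoly_homogeneous w e (fs ! k)" by simp
  then obtain e where e: "\<And>k. k < length fs \<Longrightarrow> mpoly_homogeneous w (e k) (fs ! k)" by metis
  have "quotient_series n w (take m fs) * (\<Prod>j<n. 1 - fps_X ^ w j) = (\<Prod>k<m. 1 - fps_X ^ e k)" if "m \<le> length fs" for m
    using that
  proof (induction m)
    case 0
    thus ?case using exponent_series_mult[of "{..<n}" w] w by (simp add: quotient_series_Nil)
  next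
    case (Suc m)
    hence m: "m < length fs" by simp
    have "quotient_series n w (take (Suc m) fs) = quotient_series n w (take m fs) * (1 - fps_X ^ e m)"
      unfolding take_Suc_conv_app_nth[OF m]
    proof (rule quotient_series_snoc[OF w _ _ e[OF m]])
      show "\<forall>f\<in>set (take m fs). \<exists>e. mpoly_homogeneous w e f" using hom in_set_takeD by fast
      have "set fs \<subseteq> mpoly_ring n" using reg by (simp add: regular_sequence_def)
      thus "fs ! m \<in> mpoly_ring n" using m by auto
      show "g \<in> mpoly_ideal n (take m fs)" if "g \<in> mpoly_ring n" "fs ! m * g \<in> mpoly_ideal n (take m fs)" for g
        using reg m that by (auto simp: regular_sequence_def)
    qed
    thus ?case using Suc by (simp add: mult_ac)
  qed
  from this[of "length fs"] show ?thesis
    using regular_sequence_degree_pos[OF reg w _ e] by (intro exI[of _ e]) auto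
qed

subsection \<open>Complete intersections are Hilbert-cyclotomic\<close>

lemma mpoly_coset_eq_iff: "mpoly_coset n fs p = mpoly_coset n fs q \<longleftrightarrow> p - q \<in> mpoly_ideal n fs"
proof
  assume "mpoly_coset n fs p = mpoly_coset n fs q"
  moreover have "p \<in> mpoly_coset n fs p"
    unfolding mpoly_coset_def using mpoly_ideal_0[of n fs] by (intro image_eqI[of _ _ 0]) auto
  ultimately obtain r where "r \<in> mpoly_ideal n fs" "p = q + r" by (auto simp: mpoly_coset_def)
  thus "p - q \<in> mpoly_ideal n fs" by simp
next
  have *: "mpoly_coset n fs p \<subseteq> mpoly_coset n fs q" if d: "p - q \<in> mpoly_ideal n fs" for p q
  proof
    fix x assume "x \<in> mpoly_coset n fs p"
    then obtain r where r: "r \<in> mpoly_ideal n fs" "x = p + r" by (auto simp: mpoly_coset_def)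
    have "(p - q) + r \<in> mpoly_ideal n fs" using d r by (intro mpoly_ideal_add)
    moreover have "x = q + ((p - q) + r)" by (simp add: r)
    ultimately show "x \<in> mpoly_coset n fs q" unfolding mpoly_coset_def by blast
  qed
  assume pq: "p - q \<in> mpoly_ideal n fs"
  have "- (p - q) \<in> mpoly_ideal n fs" by (rule mp.subspace_neg[OF subspace_mpoly_ideal pq])
  hence "q - p \<in> mpoly_ideal n fs" by simp
  with pq show "mpoly_coset n fs p = mpoly_coset n fs q" using *[of p q] *[of q p] by blast
qed

lemma hilbert_series_eq_quotient_series:
  fixes scale :: "'k::field \<Rightarrow> 'a::comm_ring_1 \<Rightarrow> 'a"
  assumes "vector_space scale" and w: "\<And>j. j < n \<Longrightarrow> w j > 0"
    and iso: "is_graded_quotient_iso n w fs scale gr \<Phi>"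
  shows "hilbert_series scale gr = quotient_series n w fs"
proof -
  interpret R: vector_space scale by fact
  interpret vector_space_pair "\<lambda>c p. mpoly_const c * (p :: 'k mpoly)" scale ..
  define \<phi> where "\<phi> p = \<Phi> (mpoly_coset n fs p)" for p
  have inj: "inj_on \<Phi> (mpoly_coset n fs ` mpoly_ring n)"
    and add: "\<And>p q. p \<in> mpoly_ring n \<Longrightarrow> q \<in> mpoly_ring n \<Longrightarrow> \<phi> (p + q) = \<phi> p + \<phi> q"
    and sc: "\<And>c p. p \<in> mpoly_ring n \<Longrightarrow> \<phi> (mpoly_const c * p) = scale c (\<phi> p)"
    and im: "\<And>i. \<phi> ` graded_piece n w i = gr i"
    using iso by (auto simp: is_graded_quotient_iso_def bij_betw_def \<phi>_def graded_piece_def image_image)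
  have \<phi>0: "\<phi> 0 = 0" using add[of 0 0] by (simp add: mpoly_ring_0)
  have ker: "\<phi> p = 0 \<longleftrightarrow> p \<in> mpoly_ideal n fs" if p: "p \<in> mpoly_ring n" for p
  proof -
    have "\<phi> p = 0 \<longleftrightarrow> \<Phi> (mpoly_coset n fs p) = \<Phi> (mpoly_coset n fs 0)"
      using \<phi>0 by (simp add: \<phi>_def)
    also have "\<dots> \<longleftrightarrow> mpoly_coset n fs p = mpoly_coset n fs 0"
      using inj p by (auto simp: inj_on_eq_iff mpoly_ring_0)
    finally show ?thesis by (simp add: mpoly_coset_eq_iff)
  qed
  have dims: "R.dim (gr i) + mp.dim (mpoly_ideal n fs \<inter> graded_piece n w i) = mp.dim (graded_piece n w i :: 'k mpoly set)" for i
  proof -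
    have "{u \<in> graded_piece n w i. \<phi> u = 0} = mpoly_ideal n fs \<inter> graded_piece n w i"
      using ker by (auto simp: graded_piece_def)
    thus ?thesis
      using rank_nullity[OF subspace_graded_piece[of n w i] graded_piece_basis(1,3)[where n = n and w = w and i = i, OF w], of \<phi>] add sc
      by (simp add: im) (simp add: graded_piece_def)
  qed
  have "int (R.dim (gr i)) = int (mp.dim (graded_piece n w i :: 'k mpoly set)) - int (mp.dim (mpoly_ideal n fs \<inter> graded_piece n w i))" for i
    using dims[of i] by linarith
  thus ?thesis by (simp add: hilbert_series_def quotient_series_def)
qed

lemma is_h_polynomial_h_polynomial:
  assumes "h_polynomial scale gr \<noteq> 0"
  shows "is_h_polynomial scale gr (h_polynomial scale gr)"
proof -
  from assms obtain h where h: "is_h_polynomial scale gr h"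
    by (auto simp: h_polynomial_def split: if_splits)
  hence "(THE h. is_h_polynomial scale gr h) = h"
    using is_h_polynomial_unique by (intro the_equality)
  thus ?thesis using h by (auto simp: h_polynomial_def)
qed

lemma complete_intersection_imp_unimodular:
  fixes scale :: "'k::field \<Rightarrow> 'a::comm_ring_1 \<Rightarrow> 'a" and z :: complex
  assumes vs: "vector_space scale" and ci: "complete_intersection scale gr"
    and h: "hilbert_series scale gr * (1 - fps_X) ^ d = fps_of_poly h" and h1: "poly h 1 \<noteq> 0"
    and z: "poly (map_poly of_int h) z = 0"
  shows "cmod z = 1"
proof -
  obtain n w fs \<Phi> where w: "\<And>i. i < n \<Longrightarrow> w i > 0" and hom: "\<forall>f\<in>set fs. \<exists>e. mpoly_homogeneous w e f"
    and reg: "regular_sequence n fs" and iso: "is_graded_quotient_iso n w fs scale gr \<Phi>"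
    using ci unfolding complete_intersection_def by blast
  obtain e where e: "\<And>k. k < length fs \<Longrightarrow> e k > 0"
    and q: "quotient_series n w fs * (\<Prod>j<n. 1 - fps_X ^ w j) = (\<Prod>k<length fs. 1 - fps_X ^ e k)"
    using quotient_series_regular_sequence[OF reg w hom] by blast
  define P where "P k = 1 - monom (1::int) k" for k
  have P: "fps_of_poly (P k) = 1 - fps_X ^ k" for k
    by (simp add: P_def fps_of_poly_diff fps_of_poly_monom')
  \<comment> \<open>Clearing all denominators gives an identity of polynomials, which can be
    evaluated at \<open>z\<close>, unlike the series.\<close>
  have eq: "fps_of_poly (h * (\<Prod>j<n. P (w j))) = fps_of_poly (P 1 ^ d * (\<Prod>k<length fs. P (e k)))"
    using q hilbert_series_eq_quotient_series[OF vs w iso]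
    by (simp add: fps_of_poly_mult fps_of_poly_prod fps_of_poly_power P h[symmetric] mult_ac flip: q)
  hence "h * (\<Prod>j<n. P (w j)) = P 1 ^ d * (\<Prod>k<length fs. P (e k))"
    by (simp only: fps_of_poly_eq_iff)
  from arg_cong[OF this, of "\<lambda>p. poly (map_poly of_int p) z"]
  have "poly (map_poly of_int (P 1 ^ d * (\<Prod>k<length fs. P (e k)))) z = 0"
    using z by (simp add: map_poly_of_int_mult)
  moreover have pw: "map_poly of_int (p ^ k) = (map_poly of_int p :: complex poly) ^ k" for p k
    by (induction k) (auto simp: map_poly_of_int_mult)
  moreover have pr: "map_poly of_int (prod f A) = (\<Prod>x\<in>A. map_poly of_int (f x) :: complex poly)" for f and A :: "nat set"
    by (induction A rule: infinite_finite_induct) (auto simp: map_poly_of_int_mult)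
  ultimately have "poly (map_poly of_int (P 1)) z ^ d * (\<Prod>k<length fs. poly (map_poly of_int (P (e k))) z) = 0"
    by (simp add: map_poly_of_int_mult poly_prod)
  moreover have "poly (map_poly of_int (P k)) z = 1 - z ^ k" for k
    by (simp add: P_def map_poly_of_int_diff map_poly_of_int_monom poly_monom)
  ultimately have "(1 - z) ^ d * (\<Prod>k<length fs. 1 - z ^ e k) = 0" by simp
  then obtain k where k: "z ^ k = 1" "k > 0"
    using e by (auto simp: power_0_left split: if_splits)
  hence "cmod z ^ k = 1 ^ k" by (metis norm_power norm_one power_one)
  thus ?thesis using power_eq_imp_eq_base[of "cmod z" k 1] k(2) by simp
qed

subsection \<open>Monomials in a graded algebra\<close>

context graded_algebra
begin

lemma one_in_gr_0: "1 \<in> gr 0"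
  unfolding gr_0 by (rule range_eqI[of _ _ 1]) simp

lemma scale_mult_right: "x * scale c y = scale c (x * y)"
  by (metis mult.commute scale_mult_left)

lemma component_exists: "\<exists>C. \<forall>x. (\<forall>i. C x i \<in> gr i) \<and> finite {i. C x i \<noteq> 0} \<and> x = (\<Sum>i | C x i \<noteq> 0. C x i)"
proof -
  have "\<forall>x. \<exists>c. (\<forall>i. c i \<in> gr i) \<and> finite {i. c i \<noteq> 0} \<and> x = (\<Sum>i | c i \<noteq> 0. c i)"
    by (rule allI, rule ex1_implies_ex, rule direct_sum)
  thus ?thesis by (rule choice)
qed

definition component :: "'a \<Rightarrow> nat \<Rightarrow> 'a" where
  "component = (SOME C. \<forall>x. (\<forall>i. C x i \<in> gr i) \<and> finite {i. C x i \<noteq> 0} \<and> x = (\<Sum>i | C x i \<noteq> 0. C x i))"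

lemma component: "component x i \<in> gr i" "finite {i. component x i \<noteq> 0}" "x = (\<Sum>i | component x i \<noteq> 0. component x i)"
proof -
  have *: "\<forall>x. (\<forall>i. component x i \<in> gr i) \<and> finite {i. component x i \<noteq> 0} \<and> x = (\<Sum>i | component x i \<noteq> 0. component x i)"
    unfolding component_def by (rule someI_ex[OF component_exists])
  show "component x i \<in> gr i" using * by blast
  show "finite {i. component x i \<noteq> 0}" using * by blast
  show "x = (\<Sum>i | component x i \<noteq> 0. component x i)" using *[rule_format, of x] by (elim conjE)
qed

lemma component_unique:
  assumes "\<And>i. c i \<in> gr i" "finite F" "\<And>i. i \<notin> F \<Longrightarrow> c i = 0" "x = (\<Sum>i\<in>F. c i)"
  shows "component x i = c i"
proof -
  have fin: "finite {i. c i \<noteq> 0}" by (rule finite_subset[OF _ assms(2)]) (use assms(3) in auto)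
  have "(\<Sum>i\<in>F. c i) = (\<Sum>i | c i \<noteq> 0. c i)"
    using assms(2,3) by (intro sum.mono_neutral_right) auto
  hence c: "(\<forall>i. c i \<in> gr i) \<and> finite {i. c i \<noteq> 0} \<and> x = (\<Sum>i | c i \<noteq> 0. c i)"
    using assms fin by simp
  have d: "(\<forall>i. component x i \<in> gr i) \<and> finite {i. component x i \<noteq> 0} \<and> x = (\<Sum>i | component x i \<noteq> 0. component x i)"
    by (intro conjI allI component)
  obtain u where u: "\<And>c'. (\<forall>i. c' i \<in> gr i) \<and> finite {i. c' i \<noteq> 0} \<and> x = (\<Sum>i | c' i \<noteq> 0. c' i) \<Longrightarrow> c' = u"
    using direct_sum[of x] by (elim ex1E) blast
  show ?thesis using u[OF c] u[OF d] by simp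
qed

lemma component_sum_superset:
  assumes "finite F" "{i. component x i \<noteq> 0} \<subseteq> F"
  shows "(\<Sum>i\<in>F. component x i) = x"
proof -
  have "(\<Sum>i\<in>F. component x i) = (\<Sum>i | component x i \<noteq> 0. component x i)"
    using assms by (intro sum.mono_neutral_right) auto
  thus ?thesis using component(3)[of x] by simp
qed

lemma component_add: "component (x + y) i = component x i + component y i"
proof (rule component_unique)
  let ?F = "{i. component x i \<noteq> 0} \<union> {i. component y i \<noteq> 0}"
  show "finite ?F" using component(2) by auto
  show "x + y = (\<Sum>i\<in>?F. component x i + component y i)"
    using component_sum_superset[of ?F x] component_sum_superset[of ?F y] component(2)
    by (simp add: sum.distrib)
qed (auto intro: subspace_add subspace_gr component(1))

lemma component_scale: "component (scale c x) i = scale c (component x i)"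
proof (rule component_unique)
  let ?F = "{i. component x i \<noteq> 0}"
  show "finite ?F" using component(2) by auto
  show "scale c x = (\<Sum>i\<in>?F. scale c (component x i))"
    using component(3)[of x] by (metis scale_sum_right)
qed (auto intro: subspace_scale subspace_gr component(1))

lemma component_homogeneous:
  assumes "x \<in> gr j"
  shows "component x i = (if i = j then x else 0)"
  by (rule component_unique[of "\<lambda>i. if i = j then x else 0" "{j}"])
    (use assms in \<open>auto intro: subspace_0 subspace_gr\<close>)

lemma component_sum: "component (sum f A) i = (\<Sum>a\<in>A. component (f a) i)"
  by (induction A rule: infinite_finite_induct)
     (auto simp: component_add component_homogeneous[OF subspace_0[OF subspace_gr[of 0]]])

lemma gr_sum_eq_0:
  assumes "finite F" "\<And>i. i \<in> F \<Longrightarrow> c i \<in> gr i" "(\<Sum>i\<in>F. c i) = 0" "i \<in> F"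
  shows "c i = 0"
proof -
  have "component (\<Sum>j\<in>F. c j) i = (\<Sum>j\<in>F. if i = j then c j else 0)"
    unfolding component_sum by (rule sum.cong) (use assms(2) component_homogeneous in auto)
  also have "\<dots> = c i" using assms by simp
  finally show ?thesis
    using assms(3) component_homogeneous[OF subspace_0[OF subspace_gr[of 0]]] by simp
qed

text \<open>The elements whose degree 1 part lies in the span of the degree 1 parts of the
  generators form a subalgebra: the degree 1 part of x y is x_0 y_1 + x_1 y_0, and x_0, y_0 are
  scalars. Finiteness makes \<open>dim (gr 1)\<close> the size of a finite basis.\<close>

lemma gr_1_finite_span: "\<exists>B. finite B \<and> B \<subseteq> gr 1 \<and> gr 1 \<subseteq> span B"
proof -
  obtain X where X: "finite X" "generates_algebra scale X" using finitely_generated by blast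
  define B where "B = (\<lambda>x. component x 1) ` X"
  define T where "T = {x. component x 1 \<in> span B}"
  have "is_subalgebra scale T"
    unfolding is_subalgebra_def
  proof (intro conjI ballI)
    show "subspace T"
      unfolding subspace_def T_def
      by (auto simp: component_add component_scale component_homogeneous[OF subspace_0[OF subspace_gr[of 0]]]
               intro: span_add span_scale span_zero)
    show "1 \<in> T" by (simp add: T_def component_homogeneous[OF one_in_gr_0] span_zero)
    fix x y assume x: "x \<in> T" and y: "y \<in> T"
    let ?Fx = "{i. component x i \<noteq> 0}" and ?Fy = "{i. component y i \<noteq> 0}"
    have "x * y = (\<Sum>i\<in>?Fx. \<Sum>j\<in>?Fy. component x i * component y j)"
      using component(3)[of x] component(3)[of y] by (metis sum_product)
    hence "component (x * y) 1 = (\<Sum>i\<in>?Fx. \<Sum>j\<in>?Fy. component (component x i * component y j) 1)"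
      by (simp add: component_sum)
    also have "\<dots> \<in> span B"
    proof (intro span_sum)
      fix i j
      show "component (component x i * component y j) 1 \<in> span B"
      proof (cases "i + j = 1")
        case False
        thus ?thesis
          using component_homogeneous[OF mult_gr[OF component(1) component(1)], of x i y j 1] by (simp add: span_zero)
      next
        case True
        hence c: "component (component x i * component y j) 1 = component x i * component y j"
          using component_homogeneous[OF mult_gr[OF component(1) component(1)], of x i y j 1] by simp
        consider "i = 0" "j = 1" | "i = 1" "j = 0" using True by linarith
        thus ?thesis
        proof cases
          case 1
          obtain a where "component x i = scale a 1" using component(1)[of x 0] gr_0 1 by auto
          hence e: "component x i * component y j = scale a (component y 1)"
            using 1 by (simp flip: scale_mult_left)
          show ?thesis unfolding c unfolding e using y by (simp add: T_def span_scale)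
        next
          case 2
          obtain a where "component y j = scale a 1" using component(1)[of y 0] gr_0 2 by auto
          hence e: "component x i * component y j = scale a (component x 1)"
            using 2 by (simp add: scale_mult_right)
          show ?thesis unfolding c unfolding e using x by (simp add: T_def span_scale)
        qed
      qed
    qed
    finally show "x * y \<in> T" by (simp add: T_def)
  qed
  moreover have "X \<subseteq> T" by (auto simp: T_def B_def intro: span_base)
  ultimately have "is_subalgebra scale hull X \<subseteq> T" by (intro hull_minimal)
  hence "T = UNIV" using X(2) by (auto simp: generates_algebra_def)
  have "gr 1 \<subseteq> span B"
  proof
    fix x assume "x \<in> gr 1"
    moreover have "x \<in> T" by (simp add: \<open>T = UNIV\<close>)
    ultimately show "x \<in> span B" using component_homogeneous[of x 1 1] by (simp add: T_def)
  qed
  moreover have "finite B" "B \<subseteq> gr 1" using X(1) component(1) by (auto simp: B_def)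
  ultimately show ?thesis by blast
qed

end

section \<open>Standard monomials of a standard graded algebra\<close>

locale graded_generators = standard_graded_algebra scale gr
  for scale :: "'k::field \<Rightarrow> 'a::comm_ring_1 \<Rightarrow> 'a" and gr :: "nat \<Rightarrow> 'a set" +
  fixes y :: "nat \<Rightarrow> 'a" and m :: nat
  assumes y_gr_1: "j < m \<Longrightarrow> y j \<in> gr 1"
    and gr_1_span: "gr 1 \<subseteq> span (y ` {..<m})"
    and m_dim: "m = dim (gr 1)"
begin

abbreviation deg :: "(nat \<Rightarrow>\<^sub>0 nat) \<Rightarrow> nat" where "deg \<equiv> weighted_degree (\<lambda>_. 1)"

abbreviation E :: "nat \<Rightarrow> (nat \<Rightarrow>\<^sub>0 nat) set" where "E \<equiv> exponents {..<m} (\<lambda>_. 1)"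

definition mon :: "(nat \<Rightarrow>\<^sub>0 nat) \<Rightarrow> 'a" where
  "mon a = (\<Prod>j<m. y j ^ Poly_Mapping.lookup a j)"

lemma mon_0: "mon 0 = 1" and mon_add: "mon (a + b) = mon a * mon b"
  by (simp_all add: mon_def lookup_add power_add prod.distrib)

lemma finite_E: "finite (E i)"
  by (rule finite_exponents) auto

lemma power_gr: "x \<in> gr i \<Longrightarrow> x ^ k \<in> gr (i * k)"
proof (induction k)
  case (Suc k)
  thus ?case using mult_gr[of x i "x ^ k" "i * k"] by simp
qed (simp add: one_in_gr_0)

lemma mon_gr:
  assumes "Poly_Mapping.keys a \<subseteq> {..<m}"
  shows "mon a \<in> gr (deg a)"
proof -
  have "(\<Prod>j<k. y j ^ Poly_Mapping.lookup a j) \<in> gr (\<Sum>j<k. Poly_Mapping.lookup a j)" if "k \<le> m" for k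
    using that
  proof (induction k)
    case (Suc k)
    thus ?case using mult_gr[OF Suc.IH power_gr[OF y_gr_1[of k], of "Poly_Mapping.lookup a k"]] by simp
  qed (simp add: one_in_gr_0)
  thus ?thesis using weighted_degree_altdef[OF _ assms, of "\<lambda>_. 1"] by (simp add: mon_def)
qed

lemma mon_gr_E: "a \<in> E i \<Longrightarrow> mon a \<in> gr i"
  using mon_gr[of a] by (auto simp: exponents_def)

lemma span_monomials: "span (mon ` {a. Poly_Mapping.keys a \<subseteq> {..<m}}) = UNIV"
proof -
  let ?X = "mon ` {a. Poly_Mapping.keys a \<subseteq> {..<m}}"
  have "is_subalgebra scale (span ?X)"
    unfolding is_subalgebra_def
  proof (intro conjI ballI subspace_span)
    show "1 \<in> span ?X" by (rule span_base, rule image_eqI[of _ _ 0]) (auto simp: mon_0)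
    fix u v assume u: "u \<in> span ?X" and v: "v \<in> span ?X"
    have *: "mon a * v \<in> span ?X" if a: "Poly_Mapping.keys a \<subseteq> {..<m}" for a
      using v
    proof (induction rule: span_induct_alt)
      case base
      thus ?case by (simp add: span_zero)
    next
      case (step c x w)
      then obtain b where "x = mon b" "Poly_Mapping.keys b \<subseteq> {..<m}" by auto
      moreover have "mon (a + b) \<in> span ?X"
        using a calculation by (intro span_base imageI) (simp add: keys_add_nat)
      ultimately show ?case
        using step by (simp add: distrib_left scale_mult_right mon_add span_add span_scale)
    qed
    show "u * v \<in> span ?X"
      using u
    proof (induction rule: span_induct_alt)
      case base
      thus ?case by (simp add: span_zero)
    next
      case (step c x w)
      thus ?case using * by (auto simp: distrib_right scale_mult_left[symmetric] intro!: span_add span_scale)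
    qed
  qed
  moreover have "gr 1 \<subseteq> span ?X"
  proof -
    have "y j \<in> ?X" if "j < m" for j
    proof (rule image_eqI[of _ _ "Poly_Mapping.single j 1"])
      have "mon (Poly_Mapping.single j 1) = (\<Prod>i<m. if i = j then y i else 1)"
        unfolding mon_def by (rule prod.cong) (auto simp: lookup_single when_def)
      thus "y j = mon (Poly_Mapping.single j 1)" using that by simp
    qed (use that in auto)
    hence "span (y ` {..<m}) \<subseteq> span ?X" by (intro span_mono) auto
    thus ?thesis using gr_1_span by blast
  qed
  ultimately have "is_subalgebra scale hull (gr 1) \<subseteq> span ?X" by (intro hull_minimal)
  thus ?thesis using generated_by_gr_1 by (auto simp: generates_algebra_def)
qed

lemma gr_eq_span: "gr i = span (mon ` E i)"
proof
  show "span (mon ` E i) \<subseteq> gr i"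
    using mon_gr_E by (intro span_minimal subspace_gr) auto
  show "gr i \<subseteq> span (mon ` E i)"
  proof
    fix x assume x: "x \<in> gr i"
    have "x \<in> span (mon ` {a. Poly_Mapping.keys a \<subseteq> {..<m}})" by (simp add: span_monomials)
    hence "component x i \<in> span (mon ` E i)"
    proof (induction rule: span_induct_alt)
      case base
      thus ?case by (simp add: component_homogeneous[OF subspace_0[OF subspace_gr[of 0]]] span_zero)
    next
      case (step c v w)
      then obtain a where a: "v = mon a" "Poly_Mapping.keys a \<subseteq> {..<m}" by auto
      have "component v i \<in> span (mon ` E i)"
        unfolding a(1) component_homogeneous[OF mon_gr[OF a(2)]]
        using a(2) by (auto simp: span_zero exponents_def intro!: span_base)
      thus ?case using step by (simp add: component_add component_scale span_add span_scale)
    qed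
    thus "x \<in> span (mon ` E i)" using component_homogeneous[OF x, of i] by simp
  qed
qed

text \<open>
  The exponents of the standard monomials of Groebner basis theory, for the lexicographic order on
  \<^typ>\<open>nat \<Rightarrow>\<^sub>0 nat\<close>.
\<close>

definition standard_exponents :: "(nat \<Rightarrow>\<^sub>0 nat) set" where
  "standard_exponents = {a. Poly_Mapping.keys a \<subseteq> {..<m} \<and> mon a \<notin> span (mon ` {b \<in> E (deg a). b < a})}"

text \<open>Macaulay's theorem: the standard monomials of degree i are the greedy basis of the
  component, so the algebra shares its Hilbert function with a set of monomials.\<close>

lemma card_standard_exponents: "card {a \<in> standard_exponents. deg a = i} = dim (gr i)"
proof -
  let ?J = "{a \<in> E i. mon a \<notin> span (mon ` {b \<in> E i. b < a})}"
  have eq: "{a \<in> standard_exponents. deg a = i} = ?J"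
    by (auto simp: standard_exponents_def exponents_def)
  have "dim (gr i) = dim (span (mon ` ?J))"
    using basis_of_linearly_ordered_family(3)[OF finite_E, of mon i] by (simp add: gr_eq_span)
  also have "\<dots> = card (mon ` ?J)"
    by (rule dim_span_eq_card_independent, rule basis_of_linearly_ordered_family(2)[OF finite_E])
  also have "\<dots> = card ?J"
    by (rule card_image, rule basis_of_linearly_ordered_family(1)[OF finite_E])
  finally show ?thesis by (simp only: eq)
qed

text \<open>If \<open>mon a\<close> is a combination of smaller monomials of its degree,
  multiplication by \<open>mon c\<close> gives such a combination for \<open>mon (a + c)\<close>,
  because the order is compatible with addition.\<close>

lemma standard_exponents_divisor:
  assumes "a + c \<in> standard_exponents"
  shows "a \<in> standard_exponents"
proof (rule ccontr)
  assume "a \<notin> standard_exponents"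
  moreover have k: "Poly_Mapping.keys a \<subseteq> {..<m}" "Poly_Mapping.keys c \<subseteq> {..<m}"
    using assms by (auto simp: standard_exponents_def keys_add_nat)
  ultimately have "mon a \<in> span (mon ` {b \<in> E (deg a). b < a})"
    by (simp add: standard_exponents_def)
  hence "mon c * mon a \<in> span (mon ` {b \<in> E (deg (a + c)). b < a + c})"
  proof (induction rule: span_induct_alt)
    case base
    thus ?case by (simp add: span_zero)
  next
    case (step r x w)
    then obtain b where b: "x = mon b" "b \<in> E (deg a)" "b < a" by auto
    have "b + c \<in> E (deg (a + c))"
      using b k by (auto simp: exponents_def weighted_degree_add keys_add_nat)
    hence "mon (b + c) \<in> span (mon ` {b \<in> E (deg (a + c)). b < a + c})"
      using b by (intro span_base imageI) auto
    thus ?case using step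
      by (simp add: distrib_left scale_mult_right b(1) mon_add mult.commute span_add span_scale)
  qed
  hence "mon (a + c) \<in> span (mon ` {b \<in> E (deg (a + c)). b < a + c})"
    by (simp add: mon_add mult.commute)
  thus False using assms by (simp add: standard_exponents_def)
qed

lemma zero_standard_exponent: "0 \<in> standard_exponents"
proof -
  have *: "{b \<in> E 0. b < 0} = {}"
  proof -
    have "b = 0" if "b \<in> E 0" for b
    proof (rule poly_mapping_eqI)
      fix k
      have "Poly_Mapping.lookup b k = 0" if "k \<in> Poly_Mapping.keys b"
        using \<open>b \<in> E 0\<close> that by (auto simp: exponents_def weighted_degree_def)
      thus "Poly_Mapping.lookup b k = Poly_Mapping.lookup 0 k" by (auto simp: in_keys_iff)
    qed
    thus ?thesis by auto
  qed
  show ?thesis unfolding standard_exponents_def mem_Collect_eq weighted_degree_0 * by (simp add: mon_0)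
qed

end

lemma fps_one_minus_X_power_nth:
  "((1 - fps_X :: int fps) ^ d) $ 0 = 1" "((1 - fps_X :: int fps) ^ d) $ 1 = - int d"
  by (induction d) (auto simp: fps_mult_nth_1 fps_power_zeroth)

section \<open>Relations between the generators, and hypersurfaces\<close>

context graded_generators
begin

text \<open>The substitution of \<open>y j\<close> for the j-th variable. Variables of index at
  least \<open>m\<close> are sent to 1, so that it is a ring homomorphism on the whole polynomial
  type.\<close>

definition ev :: "'k mpoly \<Rightarrow> 'a" where
  "ev p = (\<Sum>a\<in>Poly_Mapping.keys p. scale (Poly_Mapping.lookup p a) (mon a))"

lemma ev_superset:
  assumes "finite K" "Poly_Mapping.keys p \<subseteq> K"
  shows "ev p = (\<Sum>a\<in>K. scale (Poly_Mapping.lookup p a) (mon a))"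
  unfolding ev_def using assms by (intro sum.mono_neutral_left) (auto simp: in_keys_iff)

lemma ev_add: "ev (p + q) = ev p + ev q"
proof -
  let ?K = "Poly_Mapping.keys p \<union> Poly_Mapping.keys q"
  have "Poly_Mapping.keys (p + q) \<subseteq> ?K" by (rule Poly_Mapping.keys_add)
  thus ?thesis by (simp add: ev_superset[of ?K] lookup_add scale_left_distrib sum.distrib)
qed

lemma ev_0: "ev 0 = 0"
  by (simp add: ev_def)

lemma ev_single: "ev (Poly_Mapping.single a c) = scale c (mon a)"
  by (simp add: ev_def)

lemma ev_1: "ev 1 = 1"
  using ev_single[of 0 1] by (simp add: mon_0)

lemma ev_sum: "ev (sum f A) = (\<Sum>x\<in>A. ev (f x))"
  by (induction A rule: infinite_finite_induct) (auto simp: ev_0 ev_add)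

lemma ev_mult: "ev (p * q) = ev p * ev q"
proof -
  have "p * q = (\<Sum>a\<in>Poly_Mapping.keys p. \<Sum>b\<in>Poly_Mapping.keys q.
      Poly_Mapping.single (a + b) (Poly_Mapping.lookup p a * Poly_Mapping.lookup q b))"
    by (subst mpoly_sum_monomials[of p], subst mpoly_sum_monomials[of q])
       (simp add: sum_product mult_single)
  hence "ev (p * q) = (\<Sum>a\<in>Poly_Mapping.keys p. \<Sum>b\<in>Poly_Mapping.keys q.
      scale (Poly_Mapping.lookup p a * Poly_Mapping.lookup q b) (mon a * mon b))"
    by (simp only: ev_sum ev_single mon_add)
  also have "\<dots> = ev p * ev q"
    by (simp add: ev_def sum_product scale_mult_left[symmetric] scale_mult_right mult.commute)
  finally show ?thesis .
qed

lemma ev_const_mult: "ev (mpoly_const c * p) = scale c (ev p)"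
  by (simp add: ev_mult mpoly_const_def ev_single mon_0 flip: scale_mult_left)

lemma ev_diff: "ev (p - q) = ev p - ev q"
  using ev_add[of "p - q" q] by simp

abbreviation U :: "nat \<Rightarrow> 'k mpoly set" where "U \<equiv> graded_piece m (\<lambda>_. 1)"

lemma ev_graded_piece: "ev ` U i = gr i"
proof
  show "ev ` U i \<subseteq> gr i"
  proof clarify
    fix p assume "p \<in> U i"
    hence "\<And>a. a \<in> Poly_Mapping.keys p \<Longrightarrow> mon a \<in> gr i"
      by (intro mon_gr_E) (auto simp: graded_piece_def mpoly_ring_def mpoly_homogeneous_def exponents_def)
    thus "ev p \<in> gr i" unfolding ev_def by (intro subspace_sum subspace_scale subspace_gr)
  qed
  show "gr i \<subseteq> ev ` U i"
  proof
    fix x assume "x \<in> gr i"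
    hence "x \<in> span (mon ` E i)" by (simp add: gr_eq_span)
    thus "x \<in> ev ` U i"
    proof (induction rule: span_induct_alt)
      case base
      show ?case using ev_0 mp.subspace_0[OF subspace_graded_piece] by (metis image_eqI)
    next
      case (step c v w)
      then obtain a p where a: "a \<in> E i" "v = mon a" and p: "p \<in> U i" "w = ev p" by blast
      have "Poly_Mapping.single a c \<in> U i"
        using a by (auto simp: graded_piece_def mpoly_ring_def mpoly_homogeneous_def exponents_def split: if_splits)
      hence "Poly_Mapping.single a c + p \<in> U i" using p mp.subspace_add[OF subspace_graded_piece] by blast
      moreover have "scale c v + w = ev (Poly_Mapping.single a c + p)" by (simp add: ev_add ev_single a p)
      ultimately show ?case by blast
    qed
  qed
qed

lemma ev_surj: "\<exists>p\<in>mpoly_ring m. ev p = x"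
proof -
  have "\<forall>i. \<exists>p\<in>U i. ev p = component x i" using ev_graded_piece component(1) by (metis imageE)
  then obtain p where p: "\<And>i. p i \<in> U i" "\<And>i. ev (p i) = component x i" by metis
  have "ev (\<Sum>i | component x i \<noteq> 0. p i) = x"
    unfolding ev_sum p(2) using component(3) by simp
  moreover have "(\<Sum>i | component x i \<noteq> 0. p i) \<in> mpoly_ring m"
    using p(1) by (intro mpoly_ring_sum) (auto simp: graded_piece_def)
  ultimately show ?thesis by blast
qed

lemma dim_kernel_ev: "dim (gr i) + mp.dim {p \<in> U i. ev p = 0} = card (E i)"
proof -
  interpret vector_space_pair "\<lambda>c p. mpoly_const c * (p :: 'k mpoly)" scale ..
  have "dim (ev ` U i) + mp.dim {p \<in> U i. ev p = 0} = mp.dim (U i)"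
    by (rule rank_nullity[OF subspace_graded_piece graded_piece_basis(1,3)])
       (auto simp: ev_add ev_const_mult)
  thus ?thesis using graded_piece_basis(4)[of m "\<lambda>_. 1" i, where 'k='k]
    by (simp add: ev_graded_piece del: One_nat_def)
qed

lemma ev_homogeneous_component:
  assumes "p \<in> mpoly_ring m" "ev p = 0"
  shows "ev (homogeneous_component (\<lambda>_. 1) i p) = 0"
proof (cases "i \<in> deg ` Poly_Mapping.keys p")
  case True
  let ?h = "\<lambda>i. homogeneous_component (\<lambda>_. 1) i p"
  show ?thesis
  proof (rule gr_sum_eq_0[of "deg ` Poly_Mapping.keys p" "\<lambda>i. ev (?h i)"])
    show "ev (?h i) \<in> gr i" for i
      using ev_graded_piece homogeneous_component_in_graded_piece[OF assms(1)] by blast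
    show "(\<Sum>i\<in>deg ` Poly_Mapping.keys p. ev (?h i)) = 0"
      using assms(2) by (simp only: ev_sum[symmetric] sum_homogeneous_components)
  qed (use True in auto)
next
  case False
  hence "homogeneous_component (\<lambda>_. 1) i p = 0"
    by (intro poly_mapping_eqI) (auto simp: lookup_homogeneous_component, metis image_eqI in_keys_iff)
  thus ?thesis by (simp add: ev_0)
qed

text \<open>
  The least degree relation \<open>g\<close> generates the ideal of relations because \<open>(g)\<close> already accounts for
  the whole difference between the Hilbert series of the polynomial ring and that of the algebra.
\<close>

lemma hypersurface_kernel:
  assumes series: "hilbert_series scale gr = exponent_series {..<m} (\<lambda>_. 1) * (1 - fps_X ^ p)"
  obtains g where "g \<in> U p" "g \<noteq> 0" "ev g = 0"
    "\<And>q. q \<in> mpoly_ring m \<Longrightarrow> ev q = 0 \<Longrightarrow> \<exists>c\<in>mpoly_ring m. q = c * g"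
proof -
  interpret mm: vector_space_pair "\<lambda>c p. mpoly_const c * (p :: 'k mpoly)" "\<lambda>c p. mpoly_const c * (p :: 'k mpoly)" ..
  let ?K = "\<lambda>i. {q \<in> U i. ev q = 0}"
  have dimK: "mp.dim (?K i) = (if p \<le> i then card (E (i - p)) else 0)" for i
  proof -
    have "int (dim (gr i)) = (exponent_series {..<m} (\<lambda>_. 1) * (1 - fps_X ^ p)) $ i"
      by (simp add: series[symmetric] hilbert_series_def del: One_nat_def)
    also have "\<dots> = int (card (E i)) - (if p \<le> i then int (card (E (i - p))) else 0)"
      unfolding right_diff_distrib mult.commute[of _ "fps_X ^ p"]
      by (simp add: fps_X_power_mult_nth exponent_series_def)
    finally show ?thesis using dim_kernel_ev[of i] by (auto split: if_splits)
  qed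
  have subK: "mp.subspace (?K i)" for i
    using subspace_graded_piece[of m "\<lambda>_. 1" i] unfolding mp.subspace_def
    by (auto simp: ev_0 ev_add ev_const_mult)
  note basis = graded_piece_basis[of m "\<lambda>_. 1", where 'k='k, OF zero_less_one]
  have "E 0 = {0}"
    using zero_standard_exponent unfolding exponents_def
    by (auto simp: weighted_degree_0 weighted_degree_def intro!: poly_mapping_eqI simp: in_keys_iff)
  \<comment> \<open>In degree p the series falls short of that of the polynomial ring by the one
    monomial of degree 0, so there is one relation up to scalars.\<close>
  hence "mp.dim (?K p) = 1" by (simp add: dimK del: One_nat_def)
  hence "\<not> ?K p \<subseteq> {0}"
    using mp.dim_le_card[of "?K p" "{}"] by auto
  then obtain g where g: "g \<in> U p" "ev g = 0" "g \<noteq> 0" by blast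
  have hom: "\<exists>c\<in>mpoly_ring m. q = c * g" if q: "q \<in> ?K i" for q i
  proof (cases "p \<le> i")
    case False
    have "{0} = ?K i"
    proof (rule mp.subspace_dim_eq)
      show "mp.subspace {0}" by (simp add: mp.subspace_def)
      show "{0} \<subseteq> ?K i" using mp.subspace_0[OF subK] by blast
      show "mp.dim {0} = mp.dim (?K i)" using mp.dim_le_card[of "{0}" "{}"] False by (simp add: dimK del: One_nat_def)
      show "?K i \<subseteq> mp.span ((\<lambda>a. Poly_Mapping.single a 1) ` E i)" using basis(3)[of i] by blast
      show "finite ((\<lambda>a. Poly_Mapping.single a (1::'k)) ` E i)" by (rule basis(1))
    qed
    hence "q = 0 * g" using q by auto
    thus ?thesis using mpoly_ring_0 by blast
  next
    case True
    let ?f = "\<lambda>u. u * g"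
    have "mp.dim (?f ` U (i - p)) + mp.dim {u \<in> U (i - p). ?f u = 0} = mp.dim (U (i - p))"
      by (rule mm.rank_nullity[OF subspace_graded_piece basis(1,3)]) (auto simp: distrib_right mult.assoc)
    moreover have "{u \<in> U (i - p). ?f u = 0} = {0}"
      using g mp.subspace_0[OF subspace_graded_piece] by auto
    moreover have "mp.dim {0 :: 'k mpoly} = 0" using mp.dim_le_card[of "{0}" "{}"] by simp
    ultimately have d: "mp.dim (?f ` U (i - p)) = mp.dim (?K i)"
      using True by (simp add: dimK basis(4) del: One_nat_def)
    \<comment> \<open>Polynomials have no zero divisors, so multiplication by \<open>g\<close>
      preserves dimensions and the multiples of \<open>g\<close> already fill the relations of
      degree i.\<close>
    have "?f ` U (i - p) = ?K i"
    proof (rule mp.subspace_dim_eq[OF _ _ d])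
      show "mp.subspace (?f ` U (i - p))"
        unfolding mp.subspace_def
      proof (intro conjI ballI allI)
        show "0 \<in> ?f ` U (i - p)"
          using mp.subspace_0[OF subspace_graded_piece] by (intro image_eqI[of _ _ 0]) auto
        fix x y assume "x \<in> ?f ` U (i - p)" "y \<in> ?f ` U (i - p)"
        then obtain u v where "x = u * g" "y = v * g" "u \<in> U (i - p)" "v \<in> U (i - p)" by auto
        thus "x + y \<in> ?f ` U (i - p)"
          using mp.subspace_add[OF subspace_graded_piece] by (intro image_eqI[of _ _ "u + v"]) (auto simp: distrib_right)
      next
        fix c x assume "x \<in> ?f ` U (i - p)"
        then obtain u where "x = u * g" "u \<in> U (i - p)" by auto
        thus "mpoly_const c * x \<in> ?f ` U (i - p)"
          using mp.subspace_scale[OF subspace_graded_piece] by (intro image_eqI[of _ _ "mpoly_const c * u"]) (auto simp: mult.assoc)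
      qed
      show "?f ` U (i - p) \<subseteq> ?K i"
      proof clarify
        fix u assume "u \<in> U (i - p)"
        hence "u * g \<in> U ((i - p) + p)" using g by (intro graded_piece_mult)
        thus "u * g \<in> U i \<and> ev (u * g) = 0" using True g by (simp add: ev_mult)
      qed
      show "?K i \<subseteq> mp.span ((\<lambda>a. Poly_Mapping.single a 1) ` E i)" using basis(3)[of i] by blast
      show "finite ((\<lambda>a. Poly_Mapping.single a (1::'k)) ` E i)" by (rule basis(1))
    qed
    hence "q \<in> ?f ` U (i - p)" using q by simp
    thus ?thesis by (auto simp: graded_piece_def)
  qed
  show ?thesis
  proof (rule that[OF g(1,3,2)])
    fix q assume q: "q \<in> mpoly_ring m" "ev q = 0"
    let ?h = "\<lambda>i. homogeneous_component (\<lambda>_. 1) i q"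
    have "\<forall>i. \<exists>c\<in>mpoly_ring m. ?h i = c * g"
      using hom homogeneous_component_in_graded_piece[OF q(1)] ev_homogeneous_component[OF q] by blast
    then obtain c where c: "\<And>i. c i \<in> mpoly_ring m" "\<And>i. ?h i = c i * g" by metis
    have "q = (\<Sum>i\<in>deg ` Poly_Mapping.keys q. ?h i)" by (simp only: sum_homogeneous_components)
    also have "\<dots> = (\<Sum>i\<in>deg ` Poly_Mapping.keys q. c i) * g"
      unfolding c(2) by (rule sum_distrib_right[symmetric])
    finally show "\<exists>c\<in>mpoly_ring m. q = c * g"
      by (rule bexI) (intro mpoly_ring_sum c(1))
  qed
qed

lemma hypersurface_complete_intersection:
  assumes series: "hilbert_series scale gr = exponent_series {..<m} (\<lambda>_. 1) * (1 - fps_X ^ p)"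
  shows "complete_intersection scale gr"
proof -
  obtain g where g: "g \<in> U p" "g \<noteq> 0" "ev g = 0"
    and ker: "\<And>q. q \<in> mpoly_ring m \<Longrightarrow> ev q = 0 \<Longrightarrow> \<exists>c\<in>mpoly_ring m. q = c * g"
    using hypersurface_kernel[OF series] by blast
  have gr_: "g \<in> mpoly_ring m" "mpoly_homogeneous (\<lambda>_. 1) p g" using g by (auto simp: graded_piece_def)
  have ideal: "mpoly_ideal m [g] = {q \<in> mpoly_ring m. ev q = 0}"
  proof -
    have "mpoly_ideal m [g] = {c * g | c. c \<in> mpoly_ring m}"
      using mpoly_ideal_snoc[of m "[]" g] by (simp add: mpoly_ideal_Nil)
    thus ?thesis using ker g(3) gr_(1) by (auto simp: ev_mult intro: mpoly_ring_mult)
  qed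
  \<comment> \<open>Any representative of a coset may be evaluated, because the ideal is the kernel
    of \<open>ev\<close> on the polynomials in \<open>m\<close> variables.\<close>
  define \<Phi> where "\<Phi> C = ev (SOME q. q \<in> C)" for C
  have \<Phi>: "\<Phi> (mpoly_coset m [g] q) = ev q" for q
  proof -
    have "q \<in> mpoly_coset m [g] q"
      unfolding mpoly_coset_def using mpoly_ideal_0[of m "[g]"] by (intro image_eqI[of _ _ 0]) auto
    hence "(SOME q'. q' \<in> mpoly_coset m [g] q) \<in> mpoly_coset m [g] q" by (rule someI)
    then obtain r where "r \<in> mpoly_ideal m [g]" "(SOME q'. q' \<in> mpoly_coset m [g] q) = q + r"
      unfolding mpoly_coset_def by blast
    thus ?thesis by (simp add: \<Phi>_def ev_add ideal)
  qed
  have "regular_sequence m [g]"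
    unfolding regular_sequence_def
  proof (intro conjI allI impI ballI)
    show "set [g] \<subseteq> mpoly_ring m" using gr_ by simp
    fix j q assume "j < length [g]" "q \<in> mpoly_ring m" "[g] ! j * q \<in> mpoly_ideal m (take j [g])"
    thus "q \<in> mpoly_ideal m (take j [g])" using g(2) by (simp add: mpoly_ideal_Nil)
  next
    have "1 \<notin> mpoly_ideal m [g]" by (simp add: ideal ev_1)
    thus "mpoly_ideal m [g] \<noteq> mpoly_ring m" using mpoly_ring_1 by blast
  qed
  moreover have "is_graded_quotient_iso m (\<lambda>_. 1) [g] scale gr \<Phi>"
    unfolding is_graded_quotient_iso_def \<Phi>
  proof (intro conjI allI ballI)
    show "bij_betw \<Phi> (mpoly_coset m [g] ` mpoly_ring m) UNIV"
      unfolding bij_betw_def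
    proof
      show "inj_on \<Phi> (mpoly_coset m [g] ` mpoly_ring m)"
      proof (rule inj_onI, clarify)
        fix q r assume qr: "q \<in> mpoly_ring m" "r \<in> mpoly_ring m" "\<Phi> (mpoly_coset m [g] q) = \<Phi> (mpoly_coset m [g] r)"
        have "q - r \<in> mpoly_ring m" using qr mpoly_ring_add[OF _ mpoly_ring_uminus, of q m r] by simp
        thus "mpoly_coset m [g] q = mpoly_coset m [g] r"
          using qr(3) by (simp add: \<Phi> mpoly_coset_eq_iff ideal ev_diff)
      qed
      show "\<Phi> ` mpoly_coset m [g] ` mpoly_ring m = UNIV"
        using ev_surj by (auto simp: image_image \<Phi> image_iff) metis
    qed
    show "\<Phi> ` mpoly_coset m [g] ` {p \<in> mpoly_ring m. mpoly_homogeneous (\<lambda>_. 1) i p} = gr i" for i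
      using ev_graded_piece[of i] by (simp add: image_image \<Phi> graded_piece_def)
  qed (simp_all only: ev_add ev_const_mult, simp_all only: ev_mult ev_1)
  ultimately show ?thesis
    unfolding complete_intersection_def using gr_ by (intro exI[of _ m] exI[of _ "\<lambda>_. 1"] exI[of _ "[g]"] exI[of _ \<Phi>]) auto
qed

lemma unimodular_imp_complete_intersection:
  assumes h: "hilbert_series scale gr * (1 - fps_X) ^ d = fps_of_poly h"
    and h1: "poly h 1 \<noteq> 0" and h0: "poly h 0 = 1"
    and irr: "irreducible (map_poly rat_of_int h)"
    and roots: "\<And>z::complex. poly (map_poly of_int h) z = 0 \<Longrightarrow> cmod z = 1"
  shows "complete_intersection scale gr"
proof -
  define H where "H = hilbert_series scale gr"
  have Hst: "H = Abs_fps (\<lambda>i. int (card {a \<in> standard_exponents. deg a = i}))"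
    by (simp add: H_def hilbert_series_def card_standard_exponents del: One_nat_def)
  have st: "Poly_Mapping.keys a \<subseteq> {..<m}" if "a \<in> standard_exponents" for a
    using that by (simp add: standard_exponents_def)
  obtain A where A: "A \<subseteq> {..<m}" "card A = d" "{a. Poly_Mapping.keys a \<subseteq> A} \<subseteq> standard_exponents"
    using order_ideal_contains_coordinate_cone[of "{..<m}" standard_exponents d h]
      st standard_exponents_divisor zero_standard_exponent h h1
    by (metis (no_types, lifting) H_def Hst finite_lessThan)
  have "poly h 1 \<ge> 0"
    by (rule numerator_at_1_nonneg[OF h]) (simp add: hilbert_series_def)
  hence h1pos: "poly h 1 > 0" using h1 by simp
  have finA: "finite A" using A(1) finite_subset by blast
  have H0: "H $ 0 = 1"
    using arg_cong[OF h, of "\<lambda>f. f $ 0"] h0 by (simp add: H_def poly_0_coeff_0 fps_power_zeroth)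
  \<comment> \<open>The linear coefficient of H is \<open>dim (gr 1)\<close>, which is the number m
    of generators because they form a basis of \<open>gr 1\<close>; that of 1/(1 - x)^d is
    d.\<close>
  have m: "int m = int d + coeff h 1"
    using arg_cong[OF h, of "\<lambda>f. f $ 1"] H0 m_dim
    by (simp add: fps_mult_nth_1 fps_one_minus_X_power_nth(2)[unfolded One_nat_def] H_def[symmetric] fps_power_zeroth)
       (simp add: H_def hilbert_series_def)
  have ge: "exponent_series A (\<lambda>_. 1) $ i \<le> H $ i" for i
  proof -
    have "exponents A (\<lambda>_. 1) i \<subseteq> {a \<in> standard_exponents. deg a = i}"
      using A(3) by (auto simp: exponents_def)
    moreover have "finite {a \<in> standard_exponents. deg a = i}"
      using st by (intro finite_subset[OF _ finite_E[of i]]) (auto simp: exponents_def)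
    ultimately show ?thesis by (simp add: Hst exponent_series_def card_mono)
  qed
  have hdeg: "degree h > 0" using irr by (rule degree_pos_if_irreducible_rat)
  have not1: "poly h 1 \<noteq> 1"
  proof
    assume "poly h 1 = 1"
    hence "[:-1, 1:] dvd h - 1" by (subst poly_eq_0_iff_dvd[symmetric]) simp
    then obtain q where q: "h - 1 = [:-1, 1:] * q" by (elim dvdE)
    have "poly (pderiv (h - 1)) 1 = poly q 1"
      unfolding q pderiv_mult by (simp add: pderiv_pCons)
    hence q1: "poly q 1 > 0"
      using pderiv_at_1_pos[OF roots h1pos hdeg] by (simp add: pderiv_diff)
    \<comment> \<open>\<open>S\<close> is 1/(1 - x), visibly with nonnegative coefficients. The
      factor x - 1 of \<open>h - 1\<close> lowers the power of 1 - x in the denominator by one;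
      multiplying by \<open>S\<close> restores it, which also covers d = 0.\<close>
    define S where "S = exponent_series {0} (\<lambda>_. 1)"
    have S: "S * (1 - fps_X) = 1" using exponent_series_one[of "{0}"] by (simp add: S_def)
    have X: "fps_of_poly [:-1, 1:] = (- (1 - fps_X) :: int fps)"
      by (simp add: fps_of_poly_pCons fps_const_neg[symmetric])
    have "(H - exponent_series A (\<lambda>_. 1)) * (1 - fps_X) ^ d = fps_of_poly (h - 1)"
      using h exponent_series_one[OF finA] A(2) by (simp add: left_diff_distrib H_def fps_of_poly_diff)
    also have "\<dots> = - (1 - fps_X) * fps_of_poly q"
      by (simp only: q fps_of_poly_mult X)
    finally have "S * (H - exponent_series A (\<lambda>_. 1)) * (1 - fps_X) ^ d = - (S * (1 - fps_X)) * fps_of_poly q"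
      by (simp only: mult.assoc minus_mult_left[symmetric] mult_minus_right)
    hence "S * (H - exponent_series A (\<lambda>_. 1)) * (1 - fps_X) ^ d = fps_of_poly (- q)"
      by (simp add: S fps_of_poly_uminus)
    hence "poly (- q) 1 \<ge> 0"
    proof (rule numerator_at_1_nonneg)
      show "(S * (H - exponent_series A (\<lambda>_. 1))) $ i \<ge> 0" for i
        using ge by (auto simp: fps_mult_nth S_def exponent_series_def intro!: sum_nonneg)
    qed
    thus False using q1 by simp
  qed
  from unimodular_irreducible_cases[OF irr h0 h1pos roots] not1
  obtain p k where p: "prime p" and hp: "h = (\<Sum>j<p. monom 1 (p ^ k * j))" by blast
  have p1: "p > 1" using p prime_gt_1_nat by blast
  show ?thesis
  proof (cases "k = 0")
    case False
    have "coeff h 1 = (\<Sum>j<p. if p ^ k * j = 1 then 1 else 0)"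
      unfolding hp coeff_sum by (rule sum.cong) auto
    also have "\<dots> = 0" using False p1 by (intro sum.neutral) auto
    finally have "m = d" using m by simp
    \<comment> \<open>The cone now involves every variable, so all monomials are standard.\<close>
    hence Am: "A = {..<m}" using A by (simp add: card_subset_eq)
    have "{a \<in> standard_exponents. deg a = i} = E i" for i
      using A(3) st unfolding Am by (auto simp: exponents_def)
    hence "H = exponent_series {..<m} (\<lambda>_. 1)" by (simp add: Hst exponent_series_def)
    hence "fps_of_poly h = 1"
      using h exponent_series_one[of "{..<m}"] \<open>m = d\<close> by (simp add: H_def)
    hence "h = 1" by (metis fps_of_poly_1 fps_of_poly_eq_iff)
    thus ?thesis using hdeg by simp
  next
    case True
    have "coeff h 1 = (\<Sum>j<p. if j = 1 then 1 else 0)"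
      unfolding hp coeff_sum True by (rule sum.cong) auto
    also have "\<dots> = 1" using p1 by simp
    finally have md: "m = Suc d" using m by simp
    have "h * (1 - monom 1 1) = 1 - monom 1 p"
      using monom_minus_1_factor[of 1 p] by (simp add: hp True algebra_simps)
    hence "fps_of_poly h * (1 - fps_X) = (1 - fps_X ^ p :: int fps)"
      by (metis fps_of_poly_mult fps_of_poly_diff fps_of_poly_1 fps_of_poly_monom' power_one_right)
    hence "H * (1 - fps_X) ^ m = 1 - fps_X ^ p"
      by (simp add: md h[symmetric] H_def mult_ac)
    hence "exponent_series {..<m} (\<lambda>_. 1) * (H * (1 - fps_X) ^ m) = exponent_series {..<m} (\<lambda>_. 1) * (1 - fps_X ^ p)"
      by simp
    moreover have "exponent_series {..<m} (\<lambda>_. 1) * (H * (1 - fps_X) ^ m) = H * (exponent_series {..<m} (\<lambda>_. 1) * (1 - fps_X) ^ m)"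
      by (simp only: mult.left_commute)
    ultimately have "H = exponent_series {..<m} (\<lambda>_. 1) * (1 - fps_X ^ p)"
      by (simp only: exponent_series_one[OF finite_lessThan, of m, unfolded card_lessThan] mult_1_right)
    thus ?thesis unfolding H_def by (rule hypersurface_complete_intersection)
  qed
qed

end

lemma (in standard_graded_algebra) graded_generators_exist:
  "\<exists>y. graded_generators scale gr y (dim (gr 1))"
proof -
  obtain B where B: "B \<subseteq> gr 1" "independent B" "gr 1 \<subseteq> span B" "card B = dim (gr 1)"
    using basis_exists by blast
  have "finite B"
    using gr_1_finite_span B(1,2) independent_span_bound by (meson subset_trans)
  then obtain y where "bij_betw y {0..<card B} B" using ex_bij_betw_nat_finite by blast
  hence "y ` {..<dim (gr 1)} = B" by (simp add: bij_betw_def B(4) atLeast0LessThan)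
  hence "graded_generators scale gr y (dim (gr 1))"
    using B by unfold_locales auto
  thus ?thesis by blast
qed

theorem mainTheorem3:
  fixes scale :: "'k::field \<Rightarrow> 'a::comm_ring_1 \<Rightarrow> 'a"
    and gr :: "nat \<Rightarrow> 'a set"
  assumes "standard_graded_algebra scale gr"
    and "irreducible (map_poly rat_of_int (h_polynomial scale gr))"
  shows "hilbert_cyclotomic scale gr \<longleftrightarrow> complete_intersection scale gr"
proof -
  interpret standard_graded_algebra scale gr by fact
  define h where "h = h_polynomial scale gr"
  \<comment> \<open>An irreducible polynomial is nonzero, so \<open>h\<close> is not the default
    value of \<open>h_polynomial\<close> but a genuine h-polynomial.\<close>
  have "h \<noteq> 0" using assms(2) by (auto simp: h_def)
  hence "is_h_polynomial scale gr h" unfolding h_def by (rule is_h_polynomial_h_polynomial)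
  then obtain d where d: "hilbert_series scale gr * (1 - fps_X) ^ d = fps_of_poly h"
    and h1: "poly h 1 \<noteq> 0" and h0: "poly h 0 = 1"
    by (auto simp: is_h_polynomial_def)
  obtain y where "graded_generators scale gr y (dim (gr 1))" using graded_generators_exist ..
  then interpret graded_generators scale gr y "dim (gr 1)" .
  show ?thesis
  proof
    assume "hilbert_cyclotomic scale gr"
    thus "complete_intersection scale gr"
      using unimodular_imp_complete_intersection[OF d h1 h0] assms(2)
      by (simp add: hilbert_cyclotomic_def h_def)
  next
    assume "complete_intersection scale gr"
    thus "hilbert_cyclotomic scale gr"
      using complete_intersection_imp_unimodular[OF vector_space_axioms _ d h1]
      by (simp add: hilbert_cyclotomic_def h_def)
  qed
qed

end
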